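(* In the setting described in the context, suppose there exist observer gains $\Phi_1,\dots,\Phi_N$ such that the block matrix $$H_c=\begin{bmatrix}\Sigma_1&-\mathcal B_2\mathcal K_2&\cdots&-\mathcal B_N\mathcal K_N\\-\mathcal B_1\mathcal K_1&\Sigma_2&\cdots&-\mathcal B_N\mathcal K_N\\ \vdots&\vdots&\ddots&\vdots\\-\mathcal B_1\mathcal K_1&\cdots&-\mathcal B_{N-1}\mathcal K_{N-1}&\Sigma_N\end{bmatrix},\qquad \Sigma_i=\mathcal A+\mathcal B\mathcal K-\mathcal B_i\mathcal K_i-\Phi_iF_i,$$ (i.e. the $i$-th diagonal block is $\Sigma_i$ and the $(i,l)$ block, $l\neq i$, is $-\mathcal B_l\mathcal K_l$) is stable (spectral radius $<1$), and use these gains in the observers. Then, under the controllers $\bar u_i^*(k)=\mathcal K_i\hat\Upsilon_i(k)$, the observers are stable, i.e. for all initial conditions and every $i=1,\dots,N$, $$\lim_{k\to\infty}\|\hat\Upsilon_i(k)-\Upsilon(k)\|=0.$$ Moreover, if the Riccati equation has a positive definite solution $\mathcal P$ (the solution used to define $\mathcal K$), then under the distributed controllers $u_i(k)=\tilde u_i(k)+\bar u_i^*(k)$ the heterogeneous multi-agent system achieves output consensus, i.e. for all initial conditions $$\lim_{k\to\infty}\|y_i(k)-y_0(k)\|=0,\qquad i=1,\dots,N.$$ Meanwhile, the corresponding cost is asymptotically optimal: if $J^\star(s,\infty)$ denotes the value of $J(s,\infty)$ along the closed-loop trajectory and $J^*(s,\infty)=\Upsilon^T(s)\mathcal P\Upsilon(s)$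 the optimal centralized cost from the same $\Upsilon(s)$, then $J^\star(s,\infty)-J^*(s,\infty)\to0$ as $s\to\infty$.
   Context: **Agents and graph.** There are $N$ followers $x_i(k+1)=A_ix_i(k)+B_iu_i(k)$, $y_i(k)=C_ix_i(k)$, $i=1,\dots,N$, with $x_i(k)\in\mathbb R^{n_i}$, $u_i(k)\in\mathbb R^{m_i}$, $y_i(k)\in\mathbb R^q$ and matrices $A_i\in\mathbb R^{n_i\times n_i}$, $B_i\in\mathbb R^{n_i\times m_i}$, $C_i\in\mathbb R^{q\times n_i}$. The leader is $x_0(k+1)=A_0x_0(k)$, $y_0(k)=C_0x_0(k)$ with $x_0(k)\in\mathbb R^p$, $y_0(k)\in\mathbb R^q$, $A_0\in\mathbb R^{p\times p}$, $C_0\in\mathbb R^{q\times p}$; by convention $n_0=p$, $B_0=0$, $u_0=0$. The agents $0,1,\dots,N$ interact over a directed graph; $\mathcal N_i$ denotes the set of neighbours of $i$, whose state and input agent $i$ can use. Standing assumption: the graph has a spanning tree with root $0$. Fix such a tree; for each follower $i$ let $j=j(i)\in\mathcal N_i$ be its parent in the tree. Only the edges of this tree are used. **Errors and feedforward.** Put $\varepsilon_{ij}(k)=y_i(k)-y_j(k)$ for $j=j(i)$, so that $$\varepsilon_{ij}(k+1)=\varepsilon_{ij}(k)+C_i(A_i-I_{n_i})x_i(k)+C_iB_iu_i(k)-C_j(A_j-I_{n_j})x_j(k)-C_jB_ju_j(k).$$ The control is $u_i(k)=\tilde u_i(k)+\bar u_i(k)$, with feedforward part $\tilde u_i$ given,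 with $j=j(i)$, by one of: - Case 1 ($C_iB_i$ invertible): $\tilde u_i(k)=-B_i^{-1}(A_i-I_{n_i})x_i(k)+(C_iB_i)^{-1}(C_jB_j)u_j(k)+(C_iB_i)^{-1}C_j(A_j-I_{n_j})x_j(k)$; - Case 2 (the range of $A_{ij}=[-C_i(A_i-I_{n_i})\ \ C_j(A_j-I_{n_j})\ \ C_jB_j]$ is contained in the range of $C_iB_i$): $\tilde u_i(k)=-B_i^{\dagger}(A_i-I_{n_i})x_i(k)+(C_iB_i)^{\dagger}(C_jB_j)u_j(k)+(C_iB_i)^{\dagger}C_j(A_j-I_{n_j})x_j(k)$, where $\dagger$ is the Moore-Penrose inverse. Each follower is assumed to be in Case 1 or Case 2. Under this feedforward controller the output error system is converted into the standard linear system $\varepsilon_{ij}(k+1)=\varepsilon_{ij}(k)+C_iB_i\bar u_i(k)$. **Global error system.** $\Upsilon(k)\in\mathbb R^{qN}$ is the stack, for $i=1,\dots,N$, of $\varepsilon_{i\,j(i)}(k)$; $\bar u(k)$ is the stack of $\bar u_1(k),\dots,\bar u_N(k)$; $\mathcal A=I_N\otimes I_q$, $\mathcal B=\mathrm{diag}\{C_1B_1,\dots,C_NB_N\}$ (block diagonal), $\mathcal B_i$ is the $i$-th block column of $\mathcal B$. The global error system is $\Upsilon(k+1)=\mathcal A\Upsilon(k)+\sum_{i=1}^N\mathcal B_i\bar u_i(k)$. Agent $i$ measures $\mathcal Y_i(k)=F_i\Upsilon(k)$, where $F_i$ is a given matrix composed of zero and identity blocks (of size $q$) determined by the interaction among agents.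 **Cost and gain.** With symmetric weights $Q\ge0$ ($q\times q$), $R_i>0$ ($m_i\times m_i$), $\mathcal Q=I_N\otimes Q$, $R=\mathrm{diag}\{R_1,\dots,R_N\}$, the cost is $$J(s,\infty)=\sum_{k=s}^\infty[\Upsilon^T(k)\mathcal Q\Upsilon(k)+\bar u^T(k)R\bar u(k)].$$ Let $\mathcal P$ be a symmetric solution (with $R+\mathcal B^T\mathcal P\mathcal B$ invertible) of the Riccati equation $$\mathcal P=\mathcal A^T\mathcal P\mathcal A+\mathcal Q-\mathcal A^T\mathcal P\mathcal B(R+\mathcal B^T\mathcal P\mathcal B)^{-1}\mathcal B^T\mathcal P\mathcal A,$$ $\mathcal K=-(R+\mathcal B^T\mathcal P\mathcal B)^{-1}\mathcal B^T\mathcal P\mathcal A$, and $\mathcal K_i$ the $i$-th block row ($m_i$ rows) of $\mathcal K$. The centralized optimal control is $\bar u(k)=\mathcal K\Upsilon(k)$. **Distributed feedback and observers.** $\bar u_i(k)=\bar u_i^*(k)=\mathcal K_i\hat\Upsilon_i(k)$, where, for $i=1,\dots,N$, $$\hat\Upsilon_i(k+1)=\mathcal A\hat\Upsilon_i(k)+\mathcal B_i\bar u_i^*(k)+\sum_{l\ne i}\mathcal B_l\mathcal K_l\hat\Upsilon_i(k)+\Phi_i\bigl(\mathcal Y_i(k)-F_i\hat\Upsilon_i(k)\bigr)$$ with observer gain matrices $\Phi_i$.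
   Formalization: Two facts the setting asserts but that can fail are made hypotheses: in Case 2, C_iB_iB_i^†(A_i−I)=C_i(A_i−I); and, for consensus and cost, that ū=KΥ is optimal with optimal cost Υ^TPΥ from every initial state. *)

theory Defs
  imports "Jordan_Normal_Form.Spectral_Radius"
begin

subsection \<open>Matrices and vectors\<close>

definition vec_norm2 :: "real vec \<Rightarrow> real" where
  "vec_norm2 v = sqrt (v \<bullet> v)"

definition pos_semidef_mat :: "nat \<Rightarrow> real mat \<Rightarrow> bool" where
  "pos_semidef_mat d M \<longleftrightarrow> M \<in> carrier_mat d d \<and> M\<^sup>T = M \<and>
     (\<forall>v \<in> carrier_vec d. 0 \<le> v \<bullet> (M *\<^sub>v v))"

definition pos_def_mat :: "nat \<Rightarrow> real mat \<Rightarrow> bool" where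
  "pos_def_mat d M \<longleftrightarrow> M \<in> carrier_mat d d \<and> M\<^sup>T = M \<and>
     (\<forall>v \<in> carrier_vec d. v \<noteq> 0\<^sub>v d \<longrightarrow> 0 < v \<bullet> (M *\<^sub>v v))"

definition stable_mat :: "real mat \<Rightarrow> bool" where
  "stable_mat M \<longleftrightarrow> spectral_radius (map_mat complex_of_real M) < 1"

text \<open>Meaningful only for invertible matrices; otherwise the value is unspecified.\<close>

definition minv :: "real mat \<Rightarrow> real mat" where
  "minv M = the (mat_inverse M)"

text \<open>The four Penrose equations, which have exactly one solution for every real matrix.\<close>

definition is_moore_penrose :: "real mat \<Rightarrow> real mat \<Rightarrow> bool" where
  "is_moore_penrose M X \<longleftrightarrow> X \<in> carrier_mat (dim_col M) (dim_row M) \<and>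
     M * X * M = M \<and> X * M * X = X \<and> (M * X)\<^sup>T = M * X \<and> (X * M)\<^sup>T = X * M"

definition pinv :: "real mat \<Rightarrow> real mat" where
  "pinv M = (THE X. is_moore_penrose M X)"

definition mat_range :: "real mat \<Rightarrow> real vec set" where
  "mat_range M = (\<lambda>v. M *\<^sub>v v) ` carrier_vec (dim_col M)"

definition kron :: "real mat \<Rightarrow> real mat \<Rightarrow> real mat" where
  "kron M L = mat (dim_row M * dim_row L) (dim_col M * dim_col L)
     (\<lambda>(a, b). M $$ (a div dim_row L, b div dim_col L) * L $$ (a mod dim_row L, b mod dim_col L))"

subsection \<open>Block structure over the followers\<close>

text \<open>Agents are numbered \<open>0, \<dots>, N\<close> with leader \<open>0\<close>, so blocks are counted from \<open>1\<close>,
  whereas matrix and vector entries are counted from \<open>0\<close>.\<close>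

definition stack :: "nat \<Rightarrow> (nat \<Rightarrow> real vec) \<Rightarrow> real vec" where
  "stack N f = foldr (@\<^sub>v) (map f [1..<Suc N]) vNil"

definition block_diag :: "nat \<Rightarrow> (nat \<Rightarrow> real mat) \<Rightarrow> real mat" where
  "block_diag N f = diag_block_mat (map f [1..<Suc N])"

text \<open>The \<open>i\<close>-th block column and block row when the block sizes are \<open>m 1, m 2, \<dots>\<close>.\<close>

definition block_col :: "(nat \<Rightarrow> nat) \<Rightarrow> real mat \<Rightarrow> nat \<Rightarrow> real mat" where
  "block_col m M i = mat (dim_row M) (m i) (\<lambda>(a, b). M $$ (a, (\<Sum>l\<in>{1..<i}. m l) + b))"

definition block_row :: "(nat \<Rightarrow> nat) \<Rightarrow> real mat \<Rightarrow> nat \<Rightarrow> real mat" where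
  "block_row m M i = mat (m i) (dim_col M) (\<lambda>(a, b). M $$ ((\<Sum>l\<in>{1..<i}. m l) + a, b))"

text \<open>The matrix of \<open>N\<close> by \<open>N\<close> square blocks of size \<open>d\<close> whose \<open>(i, l)\<close> block is \<open>M i l\<close>.\<close>

definition block_mat :: "nat \<Rightarrow> nat \<Rightarrow> (nat \<Rightarrow> nat \<Rightarrow> real mat) \<Rightarrow> real mat" where
  "block_mat N d M = mat (N * d) (N * d)
     (\<lambda>(a, b). M (a div d + 1) (b div d + 1) $$ (a mod d, b mod d))"

text \<open>\<open>M\<close> consists of \<open>r\<close> block rows and \<open>N\<close> block columns of zero and identity blocks of size \<open>q\<close>.\<close>

definition zero_identity_blocks :: "nat \<Rightarrow> nat \<Rightarrow> nat \<Rightarrow> real mat \<Rightarrow> bool" where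
  "zero_identity_blocks r N q M \<longleftrightarrow>
     (\<exists>S \<in> carrier_mat r N. elements_mat S \<subseteq> {0, 1} \<and> M = kron S (1\<^sub>m q))"

subsection \<open>Interaction graph\<close>

text \<open>An edge \<open>(j, i)\<close> means that \<open>j\<close> is a neighbour of \<open>i\<close>, i.e. information flows from
  \<open>j\<close> to \<open>i\<close>. A spanning tree with root \<open>0\<close> is given by its parent function.\<close>

definition spanning_tree_parent :: "nat \<Rightarrow> (nat \<times> nat) set \<Rightarrow> (nat \<Rightarrow> nat) \<Rightarrow> bool" where
  "spanning_tree_parent N E par \<longleftrightarrow>
     (\<forall>i \<in> {1..N}. (par i, i) \<in> E) \<and>
     (\<forall>i \<in> {1..N}. (0, i) \<in> {(par l, l) | l. l \<in> {1..N}}\<^sup>*)"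

subsection \<open>Feedforward control\<close>

text \<open>In the following, \<open>A, B, C\<close> belong to the follower and \<open>A', B', C'\<close> to its parent.
  In the first case the control involves the inverse of \<open>B\<close>, so \<open>B\<close> is invertible;
  a follower with invertible \<open>C B\<close> and non-square \<open>B\<close> satisfies the range condition of the
  second case.\<close>

definition ff_case1 :: "real mat \<Rightarrow> real mat \<Rightarrow> bool" where
  "ff_case1 B C \<longleftrightarrow> invertible_mat (C * B) \<and> invertible_mat B"

text \<open>The range inclusion alone does not make the second feedforward control cancel the term
  \<open>C (A - I) x\<close> of the error system, since the pseudoinverse of \<open>B\<close>, and not that of \<open>C B\<close>,
  multiplies \<open>(A - I) x\<close>. The second conjunct is precisely what this cancellation requires.\<close>

definition ff_case2 :: "real mat \<Rightarrow> real mat \<Rightarrow> real mat \<Rightarrow> real mat \<Rightarrow> real mat \<Rightarrow> real mat \<Rightarrow> bool" where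
  "ff_case2 A B C A' B' C' \<longleftrightarrow>
     mat_range (mat_of_cols (dim_row C)
        (cols (- (C * (A - 1\<^sub>m (dim_row A)))) @ cols (C' * (A' - 1\<^sub>m (dim_row A'))) @ cols (C' * B')))
       \<subseteq> mat_range (C * B) \<and>
     C * B * pinv B * (A - 1\<^sub>m (dim_row A)) = C * (A - 1\<^sub>m (dim_row A))"

text \<open>The common shape of both feedforward controls: \<open>G\<close> is the (pseudo)inverse of \<open>B\<close>
  and \<open>H\<close> that of \<open>C B\<close>.\<close>

definition feedforward ::
  "real mat \<Rightarrow> real mat \<Rightarrow> real mat \<Rightarrow> real mat \<Rightarrow> real mat \<Rightarrow> real mat \<Rightarrow>
   real vec \<Rightarrow> real vec \<Rightarrow> real vec \<Rightarrow> real vec" where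
  "feedforward G H A A' B' C' x x' u' =
     - (G * (A - 1\<^sub>m (dim_row A)) *\<^sub>v x) + H * (C' * B') *\<^sub>v u'
     + H * C' * (A' - 1\<^sub>m (dim_row A')) *\<^sub>v x'"

subsection \<open>Linear quadratic control\<close>

definition riccati_solution :: "real mat \<Rightarrow> real mat \<Rightarrow> real mat \<Rightarrow> real mat \<Rightarrow> real mat \<Rightarrow> bool" where
  "riccati_solution A B Q R P \<longleftrightarrow>
     P = A\<^sup>T * P * A + Q - A\<^sup>T * P * B * minv (R + B\<^sup>T * P * B) * B\<^sup>T * P * A"

definition lq_gain :: "real mat \<Rightarrow> real mat \<Rightarrow> real mat \<Rightarrow> real mat \<Rightarrow> real mat" where
  "lq_gain A B R P = - (minv (R + B\<^sup>T * P * B) * B\<^sup>T * P * A)"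

definition stage_cost :: "real mat \<Rightarrow> real mat \<Rightarrow> real vec \<Rightarrow> real vec \<Rightarrow> real" where
  "stage_cost Q R z v = z \<bullet> (Q *\<^sub>v z) + v \<bullet> (R *\<^sub>v v)"

text \<open>Stage costs are nonnegative, so a cost is finite iff this series is summable; for a
  divergent series \<open>lq_cost\<close> is meaningless, and summability has to be stated separately.\<close>

definition finite_cost ::
  "real mat \<Rightarrow> real mat \<Rightarrow> (nat \<Rightarrow> real vec) \<Rightarrow> (nat \<Rightarrow> real vec) \<Rightarrow> nat \<Rightarrow> bool" where
  "finite_cost Q R z v s \<longleftrightarrow> summable (\<lambda>k. stage_cost Q R (z (s + k)) (v (s + k)))"

definition lq_cost ::
  "real mat \<Rightarrow> real mat \<Rightarrow> (nat \<Rightarrow> real vec) \<Rightarrow> (nat \<Rightarrow> real vec) \<Rightarrow> nat \<Rightarrow> real" where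
  "lq_cost Q R z v s = (\<Sum>k. stage_cost Q R (z (s + k)) (v (s + k)))"

definition lin_trajectory ::
  "real mat \<Rightarrow> real mat \<Rightarrow> (nat \<Rightarrow> real vec) \<Rightarrow> (nat \<Rightarrow> real vec) \<Rightarrow> bool" where
  "lin_trajectory A B z v \<longleftrightarrow> z 0 \<in> carrier_vec (dim_row A) \<and>
     (\<forall>k. v k \<in> carrier_vec (dim_col B)) \<and>
     (\<forall>k. z (Suc k) = A *\<^sub>v z k + B *\<^sub>v v k)"

text \<open>From every initial state \<open>z 0\<close>, the state feedback \<open>v = K z\<close> attains the minimal cost
  over all controls, and this minimal cost is the value of the quadratic form \<open>P\<close> at \<open>z 0\<close>.\<close>

definition lq_optimal ::
  "real mat \<Rightarrow> real mat \<Rightarrow> real mat \<Rightarrow> real mat \<Rightarrow> real mat \<Rightarrow> real mat \<Rightarrow> bool" where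
  "lq_optimal A B Q R K P \<longleftrightarrow>
     (\<forall>z v. lin_trajectory A B z v \<and> (\<forall>k. v k = K *\<^sub>v z k) \<longrightarrow>
        finite_cost Q R z v 0 \<and> lq_cost Q R z v 0 = z 0 \<bullet> (P *\<^sub>v z 0)) \<and>
     (\<forall>z v. lin_trajectory A B z v \<and> finite_cost Q R z v 0 \<longrightarrow>
        z 0 \<bullet> (P *\<^sub>v z 0) \<le> lq_cost Q R z v 0)"

end

theory Submission
  imports Defs
begin

text \<open>
  The feedforward control cancels the agents' own dynamics, so the stacked error satisfies
  \<open>\<Upsilon>(k+1) = \<A> \<Upsilon>(k) + \<B> ubar(k)\<close>. The observer errors \<open>e i = \<Upsilon>hat i - \<Upsilon>\<close>, stacked, then obey the
  autonomous recursion \<open>E(k+1) = Hc E(k)\<close>, and stability of \<open>Hc\<close> makes them decay geometrically.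
  Since \<open>ubar = \<K> \<Upsilon> + w\<close> with \<open>w\<close> linear in the observer errors, \<open>\<Upsilon>\<close> follows the optimal closed loop
  \<open>\<A> + \<B> \<K>\<close> up to an absolutely summable perturbation. Optimality together with \<open>\<P> > 0\<close> forces \<open>\<A> + \<B> \<K>\<close> to be
  stable, because the value function is the tail of a convergent series along every optimal orbit.
  Hence \<open>\<Upsilon>\<close> and \<open>ubar\<close> are absolutely summable, which gives consensus along the tree, a finite cost,
  and the convergence to \<open>0\<close> of both costs compared.
\<close>

subsection \<open>Moore-Penrose inverse\<close>

text \<open>The observers are coupled because agent \<open>i\<close> predicts the input of agent
  \<open>l\<close> as \<open>\<K>r l\<close> applied to its own estimate, while agent
  \<open>l\<close> applies \<open>\<K>r l\<close> to a different one. The mismatch is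
  \<open>\<K>r l\<close> applied to \<open>e i - e l\<close>, from which \<Upsilon> has dropped out;
  hence the error recursion is autonomous although \<Upsilon> itself depends on the errors.

  The Riccati equation with a positive definite \<P> does not by itself make the closed loop stable:
  for \<B> = 0 and \<Q> = 0 every symmetric \<P> solves it, while the closed loop is the identity.
  The premise \<open>lq_optimal\<close> excludes this, since it ties the quadratic form of \<P> to
  the cost actually incurred.

  \<open>pinv\<close> is a definite description, so nothing can be computed with it until the
  Penrose equations are known to have exactly one solution. Existence is obtained from least
  squares, with Gram-Schmidt replacing any rank or singular value argument.\<close>

lemma mult_mat_unit_vec:
  assumes "(M :: 'a :: semiring_1 mat) \<in> carrier_mat m n" "j < n"
  shows "M *\<^sub>v unit_vec n j = col M j"
  using assms by (intro eq_vecI) auto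

lemma minus_vec_eq_zero_imp_eq:
  fixes v w :: "'a :: group_add vec"
  assumes "v - w = 0\<^sub>v n" "v \<in> carrier_vec n" "w \<in> carrier_vec n"
  shows "v = w"
proof (rule eq_vecI)
  fix i assume "i < dim_vec w"
  then have i: "i < dim_vec w" "i < n" using assms(3) by auto
  have "v $ i - w $ i = (v - w) $ i" using i by simp
  also have "\<dots> = 0" using i assms(1) by simp
  finally show "v $ i = w $ i" by simp
qed (use assms in auto)

lemma scalar_prod_self_eq_0_iff:
  assumes "v \<in> carrier_vec n"
  shows "v \<bullet> v = (0::real) \<longleftrightarrow> v = 0\<^sub>v n"
  using conjugate_square_eq_0_vec[OF assms] by simp

text \<open>One step of Gram-Schmidt: the part \<open>M d\<close> of column \<open>k\<close> orthogonal to the previous columns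
  corrects the residual of \<open>z\<close>; if that part vanishes, no correction is needed.\<close>

lemma normal_equations_partial:
  fixes M :: "real mat"
  assumes M: "M \<in> carrier_mat m n"
  shows "k \<le> n \<Longrightarrow> z \<in> carrier_vec m \<Longrightarrow>
    \<exists>v \<in> carrier_vec n. (\<forall>j \<in> {k..<n}. v $ j = 0) \<and> (\<forall>j<k. col M j \<bullet> (z - M *\<^sub>v v) = 0)"
proof (induction k arbitrary: z)
  case 0
  show ?case by (intro bexI[of _ "0\<^sub>v n"]) auto
next
  case (Suc k)
  then have kn: "k < n" by simp
  have Mv [simp]: "M *\<^sub>v v \<in> carrier_vec m" for v using M by (auto intro!: carrier_vecI)
  have colM [simp]: "col M j \<in> carrier_vec m" for j using M by auto
  obtain v where v: "v \<in> carrier_vec n" "\<And>j. j \<in> {k..<n} \<Longrightarrow> v $ j = 0"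
      "\<And>j. j < k \<Longrightarrow> col M j \<bullet> (z - M *\<^sub>v v) = 0"
    using Suc by (meson Suc_leD)
  \<comment> \<open>Second use of the induction hypothesis, now with column \<open>k\<close> as the
    target: \<open>M *\<^sub>v w\<close> is its projection onto the span of the previous
    columns.\<close>
  obtain w where w: "w \<in> carrier_vec n" "\<And>j. j \<in> {k..<n} \<Longrightarrow> w $ j = 0"
      "\<And>j. j < k \<Longrightarrow> col M j \<bullet> (col M k - M *\<^sub>v w) = 0"
    using Suc.IH[of "col M k"] kn by auto
  define d where "d = unit_vec n k - w"
  define r where "r = z - M *\<^sub>v v"
  define t where "t = ((M *\<^sub>v d) \<bullet> r) / ((M *\<^sub>v d) \<bullet> (M *\<^sub>v d))"
  have d: "d \<in> carrier_vec n" using w(1) by (simp add: d_def)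
  have r: "r \<in> carrier_vec m" using Suc.prems by (simp add: r_def)
  have Md: "M *\<^sub>v d = col M k - M *\<^sub>v w"
    unfolding d_def using M w(1) kn by (subst mult_minus_distrib_mat_vec[OF M]) (auto simp: mult_mat_unit_vec)
  define v' where "v' = v + t \<cdot>\<^sub>v d"
  have res: "z - M *\<^sub>v v' = r - t \<cdot>\<^sub>v (M *\<^sub>v d)"
  proof -
    have "M *\<^sub>v v' = M *\<^sub>v v + t \<cdot>\<^sub>v (M *\<^sub>v d)"
      unfolding v'_def using v d by (simp add: mult_add_distrib_mat_vec[OF M] mult_mat_vec[OF M])
    then show ?thesis unfolding r_def using Suc.prems M by (intro eq_vecI) auto
  qed
  have orth: "col M j \<bullet> (r - t \<cdot>\<^sub>v (M *\<^sub>v d)) = 0" if "j < k" for j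
  proof -
    have "col M j \<bullet> (r - t \<cdot>\<^sub>v (M *\<^sub>v d)) = col M j \<bullet> r - t * (col M j \<bullet> (M *\<^sub>v d))"
      using r by (subst scalar_prod_minus_distrib[of _ m]) auto
    then show ?thesis using v(3)[OF that] w(3)[OF that] by (simp add: r_def Md)
  qed
  have orth_d: "(M *\<^sub>v d) \<bullet> (r - t \<cdot>\<^sub>v (M *\<^sub>v d)) = 0"
  proof -
    have "(M *\<^sub>v d) \<bullet> (r - t \<cdot>\<^sub>v (M *\<^sub>v d)) = (M *\<^sub>v d) \<bullet> r - t * ((M *\<^sub>v d) \<bullet> (M *\<^sub>v d))"
      using r by (subst scalar_prod_minus_distrib[of _ m]) auto
    moreover have "(M *\<^sub>v d) \<bullet> r = 0" if "(M *\<^sub>v d) \<bullet> (M *\<^sub>v d) = 0"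
      using that r scalar_prod_self_eq_0_iff[OF Mv, of d] by simp
    ultimately show ?thesis by (auto simp: t_def)
  qed
  \<comment> \<open>The entries of \<open>w\<close> vanish from index \<open>k\<close> on, so
    \<open>M *\<^sub>v w\<close> is a combination of the first \<open>k\<close> columns. This
    transfers orthogonality from \<open>M *\<^sub>v d\<close> to column \<open>k\<close>
    itself.\<close>
  have orth_w: "(M *\<^sub>v w) \<bullet> s = 0" if s: "s \<in> carrier_vec m" "\<And>j. j < k \<Longrightarrow> col M j \<bullet> s = 0" for s
  proof -
    have "(M *\<^sub>v w) \<bullet> s = s \<bullet> (M *\<^sub>v w)" using s by (simp add: comm_scalar_prod[of _ m])
    also have "\<dots> = (M\<^sup>T *\<^sub>v s) \<bullet> w" using transpose_vec_mult_scalar[OF M w(1) s(1)] by simp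
    also have "\<dots> = (\<Sum>j = 0..<n. (col M j \<bullet> s) * w $ j)"
      using M w(1) by (auto simp: scalar_prod_def[of _ w] intro!: sum.cong)
    also have "\<dots> = 0" using s(2) w(2) by (intro sum.neutral ballI) (metis atLeastLessThan_iff mult_eq_0_iff not_less)
    finally show ?thesis .
  qed
  have "col M k \<bullet> (r - t \<cdot>\<^sub>v (M *\<^sub>v d)) = 0"
  proof -
    have "col M k = M *\<^sub>v d + M *\<^sub>v w" unfolding Md using M by (intro eq_vecI) auto
    moreover have "r - t \<cdot>\<^sub>v (M *\<^sub>v d) \<in> carrier_vec m" using r by simp
    ultimately show ?thesis using orth_w[OF _ orth] orth_d
      by (simp add: add_scalar_prod_distrib[of _ m])
  qed
  with orth have "\<forall>j < Suc k. col M j \<bullet> (z - M *\<^sub>v v') = 0" by (auto simp: res less_Suc_eq)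
  moreover have "v' \<in> carrier_vec n" "\<forall>j \<in> {Suc k..<n}. v' $ j = 0"
    using v w(1,2) d by (auto simp: v'_def d_def)
  ultimately show ?case by blast
qed

text \<open>The normal equations are solved for each unit vector as right-hand side, and the
  solutions become the columns of \<open>V\<close>.\<close>

lemma normal_equations_solvable:
  fixes M :: "real mat"
  assumes M: "M \<in> carrier_mat m n"
  obtains V where "V \<in> carrier_mat n m" "M\<^sup>T * (M * V) = M\<^sup>T"
proof -
  have "\<exists>v \<in> carrier_vec n. M\<^sup>T *\<^sub>v (z - M *\<^sub>v v) = 0\<^sub>v n" if "z \<in> carrier_vec m" for z
    using normal_equations_partial[OF M _ that, of n] M by (fastforce intro!: eq_vecI)
  then obtain g where g: "\<And>z. z \<in> carrier_vec m \<Longrightarrow> g z \<in> carrier_vec n"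
      "\<And>z. z \<in> carrier_vec m \<Longrightarrow> M\<^sup>T *\<^sub>v (z - M *\<^sub>v g z) = 0\<^sub>v n"
    by metis
  define V where "V = mat_of_cols n (map (\<lambda>j. g (unit_vec m j)) [0..<m])"
  have V: "V \<in> carrier_mat n m" by (intro carrier_matI) (simp_all add: V_def)
  have "M\<^sup>T * (M * V) = M\<^sup>T"
  proof (rule mat_col_eqI)
    fix j assume "j < dim_col M\<^sup>T"
    then have j: "j < m" using M by simp
    have cV: "col V j = g (unit_vec m j)" using j g(1) by (simp add: V_def)
    have "M\<^sup>T *\<^sub>v (unit_vec m j - M *\<^sub>v g (unit_vec m j)) = 0\<^sub>v n" using g(2) by simp
    then have "M\<^sup>T *\<^sub>v unit_vec m j - M\<^sup>T *\<^sub>v (M *\<^sub>v g (unit_vec m j)) = 0\<^sub>v n"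
      using M by (subst (asm) mult_minus_distrib_mat_vec[of _ n m])
        (auto intro!: carrier_vecI)
    then have "M\<^sup>T *\<^sub>v (M *\<^sub>v g (unit_vec m j)) = M\<^sup>T *\<^sub>v unit_vec m j"
      by (rule minus_vec_eq_zero_imp_eq[symmetric]) (use M in \<open>auto intro!: carrier_vecI\<close>)
    moreover have "M\<^sup>T *\<^sub>v unit_vec m j = col M\<^sup>T j" using M j by (intro mult_mat_unit_vec) auto
    moreover have "col (M\<^sup>T * (M * V)) j = M\<^sup>T *\<^sub>v (M *\<^sub>v col V j)"
      using col_mult2[OF _ mult_carrier_mat[OF M V] j, of "M\<^sup>T" n] col_mult2[OF M V j] M
      by (simp del: col_mult)
    ultimately show "col (M\<^sup>T * (M * V)) j = col M\<^sup>T j" by (simp add: cV)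
  qed (use M V in auto)
  with V that show thesis by blast
qed

text \<open>Multiplying the normal equations by the transpose of \<open>V\<close> shows that the
  transpose of \<open>M * V\<close> equals itself times \<open>M * V\<close>. The product is
  symmetric, hence so is \<open>M * V\<close>; transposing the normal equations then gives
  \<open>M * V * M = M\<close>. These are the first and third Penrose equations.\<close>

lemma least_squares_inverse:
  fixes M :: "real mat"
  assumes M: "M \<in> carrier_mat m n"
  obtains V where "V \<in> carrier_mat n m" "M * V * M = M" "(M * V)\<^sup>T = M * V"
proof -
  obtain V where V: "V \<in> carrier_mat n m" and eq: "M\<^sup>T * (M * V) = M\<^sup>T"
    using normal_equations_solvable[OF M] .
  have t: "(M * V)\<^sup>T = V\<^sup>T * M\<^sup>T" using M V by (rule transpose_mult)
  have "(M * V)\<^sup>T * (M * V) = V\<^sup>T * (M\<^sup>T * (M * V))"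
    unfolding t using M V by (intro assoc_mult_mat[of _ m n _ m _ m]) auto
  then have sq: "(M * V)\<^sup>T * (M * V) = (M * V)\<^sup>T" by (simp add: eq t)
  have "((M * V)\<^sup>T * (M * V))\<^sup>T = (M * V)\<^sup>T * (M * V)"
    using M V by (subst transpose_mult[of _ m m _ m]) auto
  then have sym: "(M * V)\<^sup>T = M * V" unfolding sq by simp
  have "M\<^sup>T = M\<^sup>T * (M * V)\<^sup>T" by (simp add: eq sym)
  also have "\<dots> = (M * V * M)\<^sup>T" using M V by (intro transpose_mult[symmetric, of _ m m _ n]) auto
  finally have "M * V * M = M" by (metis transpose_transpose)
  with V sym that show thesis by blast
qed

text \<open>Urquhart's construction: \<open>V\<close> satisfies the first and third Penrose
  equations for \<open>M\<close>, and the same result for the transpose yields \<open>Y\<close> with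
  the first and fourth. Then \<open>X = Y * M * V\<close> satisfies all four, because
  \<open>M * X = M * V\<close> and \<open>X * M = Y * M\<close>.\<close>

lemma moore_penrose_exists: "\<exists>X. is_moore_penrose M X"
proof -
  define m n where "m = dim_row M" and "n = dim_col M"
  have M: "M \<in> carrier_mat m n" by (simp add: m_def n_def)
  obtain V where V: "V \<in> carrier_mat n m" "M * V * M = M" "(M * V)\<^sup>T = M * V"
    using least_squares_inverse[OF M] .
  obtain W where W: "W \<in> carrier_mat m n" "M\<^sup>T * W * M\<^sup>T = M\<^sup>T" "(M\<^sup>T * W)\<^sup>T = M\<^sup>T * W"
    using least_squares_inverse[of "M\<^sup>T" n m] M by auto
  define Y where "Y = W\<^sup>T"
  have Y: "Y \<in> carrier_mat n m" using W by (simp add: Y_def)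
  have YM: "Y * M = M\<^sup>T * W" using W M by (metis Y_def transpose_mult transpose_transpose transpose_carrier_mat)
  have YM_sym: "(Y * M)\<^sup>T = Y * M" by (simp add: YM W(3))
  have MYM: "M * (Y * M) = M"
  proof -
    have "(M * (Y * M))\<^sup>T = Y * M * M\<^sup>T"
      using M Y by (subst transpose_mult[of _ m n _ n]) (auto simp: YM_sym)
    then have "(M * (Y * M))\<^sup>T = M\<^sup>T" by (simp add: YM W(2))
    then show ?thesis by (metis transpose_transpose)
  qed
  have MVM: "M * (V * M) = M" using V M by simp
  define X where "X = Y * (M * V)"
  have X: "X \<in> carrier_mat n m" using Y M V by (simp add: X_def)
  have MX: "M * X = M * V"
  proof -
    have "M * X = M * (Y * M) * V" unfolding X_def using M Y V
      by (simp add: assoc_mult_mat[of _ m n _ n _ m])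
    then show ?thesis by (simp add: MYM)
  qed
  have XM: "X * M = Y * M"
    unfolding X_def using M Y V
    by (simp add: assoc_mult_mat[of _ n m _ m _ n] MVM)
  have "X * M * X = Y * (M * X)" using Y M X XM by (simp add: assoc_mult_mat[of _ n m _ n _ m])
  then have "X * M * X = X" by (simp add: MX flip: X_def)
  moreover have "M * X * M = M" by (simp add: MX V(2))
  ultimately have "is_moore_penrose M X"
    unfolding is_moore_penrose_def using X M V(3) YM_sym by (auto simp: MX XM)
  then show ?thesis by blast
qed

text \<open>\<open>M * X\<close> and \<open>M * Y\<close> are orthogonal projections with the same
  range, hence equal, and likewise \<open>X * M\<close> and \<open>Y * M\<close>. Then
  \<open>X = X * M * X = Y * M * X = Y * M * Y = Y\<close>.\<close>

lemma moore_penrose_unique: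
  assumes "is_moore_penrose M X" "is_moore_penrose M Y"
  shows "X = Y"
proof -
  define m n where "m = dim_row M" and "n = dim_col M"
  have M: "M \<in> carrier_mat m n" by (simp add: m_def n_def)
  have X: "X \<in> carrier_mat n m" "M * X * M = M" "X * M * X = X" "(M * X)\<^sup>T = M * X" "(X * M)\<^sup>T = X * M"
    and Y: "Y \<in> carrier_mat n m" "M * Y * M = M" "Y * M * Y = Y" "(M * Y)\<^sup>T = M * Y" "(Y * M)\<^sup>T = Y * M"
    using assms by (auto simp: is_moore_penrose_def m_def n_def)
  have "M * X = (M * Y * M * X)\<^sup>T" by (simp add: Y(2) X(4))
  also have "M * Y * M * X = (M * Y) * (M * X)"
    using M X(1) Y(1) by (intro assoc_mult_mat[of _ m m _ n _ m]) auto
  also have "\<dots>\<^sup>T = (M * X)\<^sup>T * (M * Y)\<^sup>T" using M X Y by (intro transpose_mult[of _ m m _ m]) auto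
  also have "\<dots> = M * X * M * Y" unfolding X(4) Y(4)
    using M X(1) Y(1) by (intro assoc_mult_mat[symmetric, of _ m m _ n _ m]) auto
  also have "\<dots> = M * Y" by (simp add: X(2))
  finally have MX: "M * X = M * Y" .
  have "X * M = (X * (M * Y * M))\<^sup>T" by (simp add: Y(2) X(5))
  also have "X * (M * Y * M) = (X * M) * (Y * M)"
    using M X(1) Y(1) by (simp add: assoc_mult_mat[of _ n m _ n _ n] assoc_mult_mat[of _ m n _ m _ n])
  also have "\<dots>\<^sup>T = (Y * M)\<^sup>T * (X * M)\<^sup>T" using M X Y by (intro transpose_mult[of _ n n _ n]) auto
  also have "\<dots> = Y * (M * X * M)" unfolding X(5) Y(5)
    using M X(1) Y(1) by (simp add: assoc_mult_mat[of _ n m _ n _ n] assoc_mult_mat[of _ m n _ m _ n])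
  also have "\<dots> = Y * M" by (simp add: X(2))
  finally have XM: "X * M = Y * M" .
  have "X = Y * M * X" using X(3) by (simp add: XM)
  also have "\<dots> = Y * (M * X)" using M X(1) Y(1) by simp
  also have "\<dots> = Y" unfolding MX using M Y(1,3) by simp
  finally show ?thesis .
qed

lemma is_moore_penrose_pinv: "is_moore_penrose M (pinv M)"
  unfolding pinv_def using moore_penrose_exists moore_penrose_unique by (metis the_equality)

text \<open>\<open>invertible_mat\<close> does not state the dimensions of its witness. They are
  recovered from the two products, which makes \<open>M\<close> a unit of the matrix ring, where
  \<open>mat_inverse\<close> succeeds.\<close>

lemma minv_inverse:
  assumes M: "M \<in> carrier_mat n n" and inv: "invertible_mat M"
  shows "minv M \<in> carrier_mat n n" "M * minv M = 1\<^sub>m n" "minv M * M = 1\<^sub>m n"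
proof -
  obtain X where X: "M * X = 1\<^sub>m n" "X * M = 1\<^sub>m (dim_row X)"
    using inv M by (auto simp: invertible_mat_def inverts_mat_def)
  have "dim_col (M * X) = n" "dim_col (X * M) = dim_row X" using X by simp_all
  then have Xc: "X \<in> carrier_mat n n" using M by (metis X(2) carrier_matD(2) carrier_matI index_mult_mat(3) index_one_mat(3) index_mult_mat(2))
  with X have "X * M = 1\<^sub>m n" by simp
  with Xc X(1) M have "M \<in> Units (ring_mat TYPE(real) n ())"
    by (auto simp: Units_def ring_mat_def)
  then obtain Y where "mat_inverse M = Some Y"
    using mat_inverse(1)[OF M, of "()"] by (cases "mat_inverse M") blast+
  with mat_inverse(2)[OF M this]
  show "minv M \<in> carrier_mat n n" "M * minv M = 1\<^sub>m n" "minv M * M = 1\<^sub>m n"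
    by (auto simp: minv_def)
qed

subsection \<open>Stacked vectors and block matrices\<close>

text \<open>Position of the first entry of block \<open>i\<close>, the same sum as in
  \<open>block_col\<close> and \<open>block_row\<close>. As blocks are counted from
  \<open>1\<close>, \<open>offset m (Suc N)\<close> is the total dimension of \<open>N\<close>
  blocks.\<close>

definition offset :: "(nat \<Rightarrow> nat) \<Rightarrow> nat \<Rightarrow> nat" where
  "offset m i = (\<Sum>l\<in>{1..<i}. m l)"

lemma offset_Suc: "i \<ge> 1 \<Longrightarrow> offset m (Suc i) = offset m i + m i"
  by (simp add: offset_def atLeastLessThanSuc)

lemma offset_1 [simp]: "offset m (Suc 0) = 0"
  by (simp add: offset_def)

lemma offset_const: "offset (\<lambda>_. d) i = (i - 1) * d"
  by (simp add: offset_def)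

lemma offset_mono: "i \<le> j \<Longrightarrow> offset m i \<le> offset m j"
  unfolding offset_def by (rule sum_mono2) auto

lemma offset_add_less:
  assumes "i \<in> {1..N}" "b < m i"
  shows "offset m i + b < offset m (Suc N)"
proof -
  have "offset m (Suc i) \<le> offset m (Suc N)" using assms by (intro offset_mono) auto
  then show ?thesis using assms by (simp add: offset_Suc)
qed

lemma offset_cases:
  assumes "a < offset m (Suc N)"
  obtains i b where "i \<in> {1..N}" "b < m i" "a = offset m i + b"
  using assms
proof (induction N arbitrary: thesis)
  case (Suc N)
  show ?case
  proof (cases "a < offset m (Suc N)")
    case True
    then show ?thesis using Suc by (metis atLeastAtMost_iff le_Suc_eq)
  next
    case False
    then show ?thesis
      using Suc.prems by (intro Suc.prems(1)[of "Suc N" "a - offset m (Suc N)"]) (auto simp: offset_Suc)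
  qed
qed simp

lemma sum_offset:
  fixes g :: "nat \<Rightarrow> 'a :: comm_monoid_add"
  shows "(\<Sum>c<offset m (Suc N). g c) = (\<Sum>l\<in>{1..N}. \<Sum>b<m l. g (offset m l + b))"
proof (induction N)
  case (Suc N)
  have "(\<Sum>c<k + j. g c) = (\<Sum>c<k. g c) + (\<Sum>b<j. g (k + b))" for k j
    by (induction j) (simp_all add: add.assoc)
  then show ?case using Suc by (simp add: offset_Suc)
qed simp

lemma append_vec_assoc: "(u @\<^sub>v v) @\<^sub>v w = u @\<^sub>v (v @\<^sub>v w)"
  by (intro eq_vecI) auto

lemma append_vec_vNil_right [simp]: "v @\<^sub>v vNil = v"
  by (intro eq_vecI) auto

lemma foldr_append_vec: "foldr (@\<^sub>v) vs v = foldr (@\<^sub>v) vs vNil @\<^sub>v v"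
  by (induction vs) (simp_all add: append_vec_assoc)

lemma stack_0 [simp]: "stack 0 f = vNil"
  by (simp add: stack_def)

lemma stack_Suc: "stack (Suc N) f = stack N f @\<^sub>v f (Suc N)"
  using foldr_append_vec[of "map f [1..<Suc N]" "f (Suc N)"] by (simp add: stack_def)

lemma stack_carrier:
  "(\<And>i. i \<in> {1..N} \<Longrightarrow> f i \<in> carrier_vec (m i)) \<Longrightarrow> stack N f \<in> carrier_vec (offset m (Suc N))"
proof (induction N)
  case (Suc N)
  then show ?case by (auto simp: stack_Suc offset_Suc intro!: append_carrier_vec)
qed (auto intro: carrier_vecI)

lemma stack_index:
  "(\<And>i. i \<in> {1..N} \<Longrightarrow> f i \<in> carrier_vec (m i)) \<Longrightarrow> i \<in> {1..N} \<Longrightarrow> b < m i \<Longrightarrow>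
    stack N f $ (offset m i + b) = f i $ b"
proof (induction N)
  case (Suc N)
  have c: "dim_vec (stack N f) = offset m (Suc N)"
    using Suc.prems(1) by (intro carrier_vecD stack_carrier) auto
  have d: "dim_vec (f (Suc N)) = m (Suc N)"
    using Suc.prems(1)[of "Suc N"] by (intro carrier_vecD) auto
  show ?case
  proof (cases "i = Suc N")
    case True
    then show ?thesis using Suc.prems(3) by (simp add: stack_Suc c d)
  next
    case False
    then have i: "i \<in> {1..N}" using Suc.prems(2) by auto
    show ?thesis
      using Suc.IH[OF Suc.prems(1) i Suc.prems(3)] offset_add_less[of i N b m] i Suc.prems(3)
      by (simp add: stack_Suc c)
  qed
qed simp

lemma stack_eqI:
  assumes f: "\<And>i. i \<in> {1..N} \<Longrightarrow> f i \<in> carrier_vec (m i)"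
    and v: "v \<in> carrier_vec (offset m (Suc N))"
    and eq: "\<And>i b. i \<in> {1..N} \<Longrightarrow> b < m i \<Longrightarrow> v $ (offset m i + b) = f i $ b"
  shows "v = stack N f"
proof (rule eq_vecI)
  have d: "dim_vec (stack N f) = offset m (Suc N)"
    using f by (intro carrier_vecD stack_carrier)
  then show "dim_vec v = dim_vec (stack N f)" using v by simp
  fix a assume "a < dim_vec (stack N f)"
  then obtain i b where "i \<in> {1..N}" "b < m i" "a = offset m i + b"
    using offset_cases unfolding d by blast
  then show "v $ a = stack N f $ a" using eq stack_index[of N f m i b, OF f] by simp
qed

lemma stack_cong: "(\<And>i. i \<in> {1..N} \<Longrightarrow> f i = g i) \<Longrightarrow> stack N f = stack N g"
  unfolding stack_def by (intro arg_cong[where f = "\<lambda>vs. foldr (@\<^sub>v) vs vNil"] map_cong) auto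

lemma stack_add:
  assumes "\<And>i. i \<in> {1..N} \<Longrightarrow> f i \<in> carrier_vec (m i)" "\<And>i. i \<in> {1..N} \<Longrightarrow> g i \<in> carrier_vec (m i)"
  shows "stack N f + stack N g = stack N (\<lambda>i. f i + g i)"
proof (rule stack_eqI[of N _ m])
  have c: "stack N f \<in> carrier_vec (offset m (Suc N))" "stack N g \<in> carrier_vec (offset m (Suc N))"
    using assms by (auto intro: stack_carrier)
  then show "stack N f + stack N g \<in> carrier_vec (offset m (Suc N))" by simp
  fix i b assume i: "i \<in> {1..N}" and b: "b < m i"
  have "dim_vec (stack N g) = offset m (Suc N)" "(f i + g i) $ b = f i $ b + g i $ b"
    using c assms(2)[OF i] b by auto
  then show "(stack N f + stack N g) $ (offset m i + b) = (f i + g i) $ b"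
    using offset_add_less[of i N b m] stack_index[of N f m i b] stack_index[of N g m i b] assms i b
    by simp
qed (use assms in auto)

lemma mult_mat_vec_index:
  assumes "M \<in> carrier_mat nr nc" "v \<in> carrier_vec nc" "a < nr"
  shows "(M *\<^sub>v v) $ a = (\<Sum>c<nc. M $$ (a, c) * v $ c)"
  using assms by (auto simp: scalar_prod_def lessThan_atLeast0 intro!: sum.cong)

lemma block_col_carrier [simp]: "M \<in> carrier_mat nr nc \<Longrightarrow> block_col m M i \<in> carrier_mat nr (m i)"
  by (simp add: block_col_def)

lemma block_row_carrier [simp]: "M \<in> carrier_mat nr nc \<Longrightarrow> block_row m M i \<in> carrier_mat (m i) nc"
  by (simp add: block_row_def)

lemma block_col_index:
  "a < dim_row M \<Longrightarrow> b < m i \<Longrightarrow> block_col m M i $$ (a, b) = M $$ (a, offset m i + b)"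
  by (simp add: block_col_def offset_def)

lemma block_row_index:
  "a < m i \<Longrightarrow> b < dim_col M \<Longrightarrow> block_row m M i $$ (a, b) = M $$ (offset m i + a, b)"
  by (simp add: block_row_def offset_def)

lemma mult_mat_stack:
  assumes M: "M \<in> carrier_mat d (offset m (Suc N))"
    and f: "\<And>i. i \<in> {1..N} \<Longrightarrow> f i \<in> carrier_vec (m i)"
  shows "M *\<^sub>v stack N f = finsum_vec TYPE(real) d (\<lambda>l. block_col m M l *\<^sub>v f l) {1..N}"
proof (rule eq_vecI)
  have fin: "finsum_vec TYPE(real) d (\<lambda>l. block_col m M l *\<^sub>v f l) {1..N} \<in> carrier_vec d"
    by (intro finsum_vec_closed) (auto intro!: mult_mat_vec_carrier[OF block_col_carrier[OF M, of m] f])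
  then show "dim_vec (M *\<^sub>v stack N f) = dim_vec (finsum_vec TYPE(real) d (\<lambda>l. block_col m M l *\<^sub>v f l) {1..N})"
    using M by auto
  fix a assume "a < dim_vec (finsum_vec TYPE(real) d (\<lambda>l. block_col m M l *\<^sub>v f l) {1..N})"
  then have a: "a < d" using fin by auto
  have "(M *\<^sub>v stack N f) $ a = (\<Sum>l\<in>{1..N}. \<Sum>b<m l. M $$ (a, offset m l + b) * stack N f $ (offset m l + b))"
    by (subst mult_mat_vec_index[OF M stack_carrier a]) (use f in \<open>auto simp: sum_offset\<close>)
  also have "\<dots> = (\<Sum>l\<in>{1..N}. (block_col m M l *\<^sub>v f l) $ a)"
  proof (intro sum.cong refl)
    fix l assume l: "l \<in> {1..N}"
    show "(\<Sum>b<m l. M $$ (a, offset m l + b) * stack N f $ (offset m l + b)) = (block_col m M l *\<^sub>v f l) $ a"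
      using M a f[OF l] stack_index[of N f m l, OF f l]
      by (subst mult_mat_vec_index[of _ d "m l"]) (auto simp: block_col_index intro!: sum.cong)
  qed
  also have "\<dots> = finsum_vec TYPE(real) d (\<lambda>l. block_col m M l *\<^sub>v f l) {1..N} $ a"
    using a by (intro index_finsum_vec[symmetric])
      (auto intro!: mult_mat_vec_carrier[OF block_col_carrier[OF M, of m] f])
  finally show "(M *\<^sub>v stack N f) $ a = finsum_vec TYPE(real) d (\<lambda>l. block_col m M l *\<^sub>v f l) {1..N} $ a" .
qed

lemma stack_block_row:
  assumes M: "M \<in> carrier_mat (offset m (Suc N)) d" and v: "v \<in> carrier_vec d"
  shows "M *\<^sub>v v = stack N (\<lambda>i. block_row m M i *\<^sub>v v)"
proof (rule stack_eqI[of N _ m])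
  fix i b assume i: "i \<in> {1..N}" and b: "b < m i"
  show "(M *\<^sub>v v) $ (offset m i + b) = (block_row m M i *\<^sub>v v) $ b"
    using mult_mat_vec_index[OF M v offset_add_less[of _ N _ m, OF i b]]
      mult_mat_vec_index[OF block_row_carrier[OF M, of m i] v b] M b by (simp add: block_row_index)
next
  show "M *\<^sub>v v \<in> carrier_vec (offset m (Suc N))" using M v by (rule mult_mat_vec_carrier)
  show "block_row m M i *\<^sub>v v \<in> carrier_vec (m i)" for i
    using block_row_carrier[OF M] v by (rule mult_mat_vec_carrier)
qed

text \<open>Stated for an arbitrary list so that induction can peel off the first block. Both claims
  go through one induction because multiplying the four-block matrix needs the dimension of the
  remaining stack.\<close>

lemma diag_block_mat_mult_append:
  assumes "\<And>i. i \<in> set is \<Longrightarrow> f i \<in> carrier_vec (dim_col (D i))"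
  shows "diag_block_mat (map D is) *\<^sub>v foldr (@\<^sub>v) (map f is) vNil
    = foldr (@\<^sub>v) (map (\<lambda>i. D i *\<^sub>v f i) is) vNil"
    and "foldr (@\<^sub>v) (map f is) vNil \<in> carrier_vec (dim_col (diag_block_mat (map D is)))"
  using assms
proof (induction "is")
  case (Cons i "is")
  let ?D = "diag_block_mat (map D is)" and ?f = "foldr (@\<^sub>v) (map f is) vNil"
  { case 1
    have "four_block_mat (D i) (0\<^sub>m (dim_row (D i)) (dim_col ?D)) (0\<^sub>m (dim_row ?D) (dim_col (D i))) ?D
        *\<^sub>v (f i @\<^sub>v ?f) =
      (D i *\<^sub>v f i + 0\<^sub>m (dim_row (D i)) (dim_col ?D) *\<^sub>v ?f) @\<^sub>v
      (0\<^sub>m (dim_row ?D) (dim_col (D i)) *\<^sub>v f i + ?D *\<^sub>v ?f)"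
      using Cons.IH(2) 1 by (intro four_block_mat_mult_vec) auto
    also have "\<dots> = D i *\<^sub>v f i @\<^sub>v (?D *\<^sub>v ?f)"
      using Cons.IH(2) 1
      by (intro arg_cong2[where f = "(@\<^sub>v)"] eq_vecI) auto
    finally show ?case using Cons.IH(1) 1 by (simp add: Let_def)
  next
    case 2
    then show ?case using Cons.IH(2) by (auto simp: Let_def intro!: append_carrier_vec)
  }
qed (auto intro!: eq_vecI carrier_vecI)

lemma block_diag_mult_stack:
  assumes "\<And>i. i \<in> {1..N} \<Longrightarrow> f i \<in> carrier_vec (dim_col (D i))"
  shows "block_diag N D *\<^sub>v stack N f = stack N (\<lambda>i. D i *\<^sub>v f i)"
  using assms unfolding block_diag_def stack_def by (intro diag_block_mat_mult_append) auto

lemma block_diag_carrier: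
  assumes "\<And>i. i \<in> {1..N} \<Longrightarrow> D i \<in> carrier_mat (r i) (c i)"
  shows "block_diag N D \<in> carrier_mat (offset r (Suc N)) (offset c (Suc N))"
proof -
  have "(\<Sum>l\<leftarrow>[1..<Suc N]. dim_row (D l)) = offset r (Suc N)"
    "(\<Sum>l\<leftarrow>[1..<Suc N]. dim_col (D l)) = offset c (Suc N)"
    using assms unfolding offset_def interv_sum_list_conv_sum_set_nat set_upt
    by (intro sum.cong refl; fastforce)+
  then show ?thesis
    unfolding block_diag_def by (intro carrier_matI) (simp_all del: upt_Suc add: dim_diag_block_mat o_def)
qed

lemma block_mat_mult_stack:
  assumes M: "\<And>i l. i \<in> {1..N} \<Longrightarrow> l \<in> {1..N} \<Longrightarrow> M i l \<in> carrier_mat d d"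
    and f: "\<And>i. i \<in> {1..N} \<Longrightarrow> f i \<in> carrier_vec d"
  shows "block_mat N d M *\<^sub>v stack N f
    = stack N (\<lambda>i. finsum_vec TYPE(real) d (\<lambda>l. M i l *\<^sub>v f l) {1..N})"
proof (rule stack_eqI[of N _ "\<lambda>_. d"])
  have off: "offset (\<lambda>_. d) (Suc N) = N * d" by (simp add: offset_const)
  have bm: "block_mat N d M \<in> carrier_mat (N * d) (offset (\<lambda>_. d) (Suc N))"
    by (simp add: block_mat_def off)
  show "block_mat N d M *\<^sub>v stack N f \<in> carrier_vec (offset (\<lambda>_. d) (Suc N))"
    using bm by (auto intro!: carrier_vecI simp: off)
  fix i assume i: "i \<in> {1..N}"
  show "finsum_vec TYPE(real) d (\<lambda>l. M i l *\<^sub>v f l) {1..N} \<in> carrier_vec d"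
    using M f i by (intro finsum_vec_closed) (auto intro!: mult_mat_vec_carrier[of _ d d])
  fix b assume b: "b < d"
  let ?a = "offset (\<lambda>_. d) i + b"
  have a: "?a < N * d" using offset_add_less[of i N b "\<lambda>_. d"] i b by (simp add: off)
  have "(block_mat N d M *\<^sub>v stack N f) $ ?a
    = (\<Sum>l\<in>{1..N}. \<Sum>c<d. block_mat N d M $$ (?a, offset (\<lambda>_. d) l + c) * stack N f $ (offset (\<lambda>_. d) l + c))"
    by (subst mult_mat_vec_index[OF bm stack_carrier a]) (use f in \<open>auto simp: sum_offset\<close>)
  also have "\<dots> = (\<Sum>l\<in>{1..N}. (M i l *\<^sub>v f l) $ b)"
  proof (intro sum.cong refl)
    fix l assume l: "l \<in> {1..N}"
    have "block_mat N d M $$ (?a, offset (\<lambda>_. d) l + c) = M i l $$ (b, c)" if c: "c < d" for c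
    proof -
      have "offset (\<lambda>_. d) l + c < N * d" using offset_add_less[of l N c "\<lambda>_. d"] l c by (simp add: off)
      then show ?thesis using a b c i l by (simp add: block_mat_def offset_const)
    qed
    then show "(\<Sum>c<d. block_mat N d M $$ (?a, offset (\<lambda>_. d) l + c) * stack N f $ (offset (\<lambda>_. d) l + c))
        = (M i l *\<^sub>v f l) $ b"
      using l f stack_index[of N f "\<lambda>_. d" l]
      by (subst mult_mat_vec_index[OF M[OF i l] _ b]) (auto intro!: sum.cong)
  qed
  also have "\<dots> = finsum_vec TYPE(real) d (\<lambda>l. M i l *\<^sub>v f l) {1..N} $ b"
    using M f i b by (intro index_finsum_vec[symmetric]) (auto intro!: mult_mat_vec_carrier[of _ d d])
  finally show "(block_mat N d M *\<^sub>v stack N f) $ ?a = finsum_vec TYPE(real) d (\<lambda>l. M i l *\<^sub>v f l) {1..N} $ b" .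
qed

lemma kron_one_one: "kron (1\<^sub>m N) (1\<^sub>m q) = 1\<^sub>m (N * q)"
proof (rule eq_matI)
  fix a b assume "a < dim_row (1\<^sub>m (N * q) :: real mat)" "b < dim_col (1\<^sub>m (N * q) :: real mat)"
  then have ab: "a < N * q" "b < N * q" by auto
  then have "a div q < N" "b div q < N" "q > 0" by (auto simp: less_mult_imp_div_less intro: gr0I)
  moreover have "a = b" if "a div q = b div q" "a mod q = b mod q"
    using that by (metis div_mult_mod_eq)
  ultimately show "kron (1\<^sub>m N) (1\<^sub>m q) $$ (a, b) = 1\<^sub>m (N * q) $$ (a, b)"
    using ab by (auto simp: kron_def)
qed (auto simp: kron_def)

subsection \<open>Stable matrices and absolutely summable orbits\<close>

text \<open>A spectral radius below \<open>1\<close> gives bounded powers through the Jordan normal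
  form. Geometric decay follows by applying this to \<open>M\<close> divided by some \<rho> strictly
  between the spectral radius and \<open>1\<close>: an eigenvector of the scaled matrix for \<mu> is
  one of \<open>M\<close> for \<rho> times \<mu>, so the scaled matrix still has spectral radius
  below \<open>1\<close>.\<close>

lemma stable_mat_power_bound:
  assumes M: "M \<in> carrier_mat n n" and n: "n > 0" and stable: "stable_mat M"
  obtains \<rho> c where "0 < \<rho>" "\<rho> < 1"
    "\<forall>k. \<forall>i<n. \<forall>j<n. \<bar>(M ^\<^sub>m k) $$ (i, j)\<bar> \<le> c * \<rho> ^ k"
proof -
  let ?M = "map_mat complex_of_real M"
  have cM: "?M \<in> carrier_mat n n" using M by simp
  \<comment> \<open>The \<open>max 0\<close> secures \<rho> > 0, so that scaling by
    \<open>1 / \<rho>\<close> is legitimate.\<close>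
  obtain \<rho> where \<rho>: "max 0 (spectral_radius ?M) < \<rho>" "\<rho> < 1"
    using stable dense[of "max 0 (spectral_radius ?M)" 1] by (auto simp: stable_mat_def)
  define L where "L = complex_of_real (1 / \<rho>) \<cdot>\<^sub>m ?M"
  have L: "L \<in> carrier_mat n n" using M by (simp add: L_def)
  have "spectral_radius L \<in> norm ` spectrum L" by (rule spectral_radius_mem_max[OF L n])
  then obtain \<mu> v where sr: "spectral_radius L = norm \<mu>" and v: "eigenvector L v \<mu>"
    by (auto simp: spectrum_def eigenvalue_def)
  have vc: "v \<in> carrier_vec n" using v L by (simp add: eigenvector_def)
  have Lv: "L *\<^sub>v v = complex_of_real (1 / \<rho>) \<cdot>\<^sub>v (?M *\<^sub>v v)"
    unfolding L_def using M vc by (intro eq_vecI) auto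
  have "?M *\<^sub>v v = complex_of_real \<rho> \<cdot>\<^sub>v (L *\<^sub>v v)"
    unfolding Lv using \<rho> by (intro eq_vecI) (auto simp: field_simps)
  also have "\<dots> = (complex_of_real \<rho> * \<mu>) \<cdot>\<^sub>v v"
    using v by (simp add: eigenvector_def smult_smult_assoc)
  finally have "eigenvector ?M v (complex_of_real \<rho> * \<mu>)"
    using v L M by (auto simp: eigenvector_def)
  then have "norm (complex_of_real \<rho> * \<mu>) \<in> norm ` spectrum ?M"
    unfolding spectrum_def eigenvalue_def by blast
  then have "norm (complex_of_real \<rho> * \<mu>) \<le> spectral_radius ?M"
    by (rule spectral_radius_mem_max(2)[OF cM n])
  then have "\<rho> * norm \<mu> \<le> spectral_radius ?M" using \<rho> by (simp add: norm_mult)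
  also have "\<dots> < \<rho> * 1" using \<rho> by simp
  finally have "spectral_radius L < 1"
    unfolding sr using \<rho> mult_less_cancel_left_pos[of \<rho> "norm \<mu>" 1] by simp
  then obtain c where c: "\<And>k. norm_bound (L ^\<^sub>m k) c"
    using spectral_radius_jnf_norm_bound_less_1_upper_triangular[OF L] by blast
  have pow: "(L ^\<^sub>m k) $$ (i, j) = complex_of_real ((M ^\<^sub>m k) $$ (i, j) / \<rho> ^ k)"
    if "i < n" "j < n" for k i j
    using that
  proof (induction k arbitrary: j)
    case (Suc k)
    have Lk: "L ^\<^sub>m k \<in> carrier_mat n n" and Mk: "M ^\<^sub>m k \<in> carrier_mat n n"
      using L M by simp_all
    have "(L ^\<^sub>m Suc k) $$ (i, j) = (\<Sum>l<n. (L ^\<^sub>m k) $$ (i, l) * L $$ (l, j))"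
      using Suc.prems L Lk by (auto simp: scalar_prod_def lessThan_atLeast0 intro!: sum.cong)
    also have "\<dots> = (\<Sum>l<n. complex_of_real ((M ^\<^sub>m k) $$ (i, l) * M $$ (l, j) / \<rho> ^ Suc k))"
      using Suc M by (intro sum.cong) (auto simp: L_def)
    also have "\<dots> = complex_of_real ((\<Sum>l<n. (M ^\<^sub>m k) $$ (i, l) * M $$ (l, j)) / \<rho> ^ Suc k)"
      by (simp add: sum_divide_distrib)
    also have "(\<Sum>l<n. (M ^\<^sub>m k) $$ (i, l) * M $$ (l, j)) = (M ^\<^sub>m Suc k) $$ (i, j)"
      using Suc.prems M Mk by (auto simp: scalar_prod_def lessThan_atLeast0 intro!: sum.cong)
    finally show ?case .
  qed (use L M in auto)
  have "\<bar>(M ^\<^sub>m k) $$ (i, j)\<bar> \<le> c * \<rho> ^ k" if ij: "i < n" "j < n" for k i j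
  proof -
    have "norm ((L ^\<^sub>m k) $$ (i, j)) \<le> c" using c[of k] ij L by (simp add: norm_bound_def)
    then have "\<bar>(M ^\<^sub>m k) $$ (i, j)\<bar> / \<rho> ^ k \<le> c"
      using \<rho> ij by (simp add: pow norm_divide norm_power del: of_real_divide)
    then show ?thesis using \<rho> by (simp add: field_simps)
  qed
  moreover have "0 < \<rho>" using \<rho> by simp
  ultimately show thesis using \<rho>(2) that by blast
qed

text \<open>Entrywise absolute summability is the invariant carried through the argument: it
  survives sums, matrix multiplication and perturbed stable recursions, and it yields both
  convergence to \<open>0\<close> and summable quadratic costs. Bare convergence to \<open>0\<close>
  would not give a finite cost.\<close>

definition l1_seq :: "nat \<Rightarrow> (nat \<Rightarrow> real vec) \<Rightarrow> bool" where
  "l1_seq n z \<longleftrightarrow> (\<forall>k. z k \<in> carrier_vec n) \<and> (\<forall>a<n. summable (\<lambda>k. \<bar>z k $ a\<bar>))"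

lemma l1_seqI:
  "(\<And>k. z k \<in> carrier_vec n) \<Longrightarrow> (\<And>a. a < n \<Longrightarrow> summable (\<lambda>k. \<bar>z k $ a\<bar>)) \<Longrightarrow> l1_seq n z"
  by (simp add: l1_seq_def)

lemma l1_seq_carrier: "l1_seq n z \<Longrightarrow> z k \<in> carrier_vec n"
  by (simp add: l1_seq_def)

lemma l1_seq_summable: "l1_seq n z \<Longrightarrow> a < n \<Longrightarrow> summable (\<lambda>k. \<bar>z k $ a\<bar>)"
  by (simp add: l1_seq_def)

lemma l1_seq_zero: "l1_seq n (\<lambda>k. 0\<^sub>v n)"
  by (simp add: l1_seq_def)

lemma l1_seq_add:
  assumes "l1_seq n z" "l1_seq n w"
  shows "l1_seq n (\<lambda>k. z k + w k)"
proof (rule l1_seqI)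
  fix a assume a: "a < n"
  have "summable (\<lambda>k. \<bar>z k $ a\<bar> + \<bar>w k $ a\<bar>)"
    using assms a by (intro summable_add l1_seq_summable)
  then show "summable (\<lambda>k. \<bar>(z k + w k) $ a\<bar>)"
    using a carrier_vecD[OF l1_seq_carrier[OF assms(2)]]
    by (elim summable_comparison_test_ev[rotated]) (intro always_eventually, auto)
qed (use assms in \<open>auto simp: l1_seq_carrier\<close>)

lemma l1_seq_mult_mat:
  assumes M: "M \<in> carrier_mat m n" and z: "l1_seq n z"
  shows "l1_seq m (\<lambda>k. M *\<^sub>v z k)"
proof (rule l1_seqI)
  fix a assume a: "a < m"
  have "summable (\<lambda>k. \<Sum>c<n. \<bar>M $$ (a, c)\<bar> * \<bar>z k $ c\<bar>)"
    using z by (intro summable_sum summable_mult l1_seq_summable) auto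
  moreover have "norm \<bar>(M *\<^sub>v z k) $ a\<bar> \<le> (\<Sum>c<n. \<bar>M $$ (a, c)\<bar> * \<bar>z k $ c\<bar>)" for k
    unfolding mult_mat_vec_index[OF M l1_seq_carrier[OF z] a] real_norm_def abs_idempotent
    by (rule order_trans[OF sum_abs]) (simp add: abs_mult)
  ultimately show "summable (\<lambda>k. \<bar>(M *\<^sub>v z k) $ a\<bar>)"
    by (rule summable_comparison_test'[where N = 0])
qed (rule mult_mat_vec_carrier[OF M l1_seq_carrier[OF z]])

text \<open>Used in both directions: to take apart the stacked observer errors and \<Upsilon>, and
  to assemble the perturbation of the optimal control.\<close>

lemma l1_seq_stack_iff:
  assumes c: "\<And>i k. i \<in> {1..N} \<Longrightarrow> f i k \<in> carrier_vec (m i)"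
  shows "l1_seq (offset m (Suc N)) (\<lambda>k. stack N (\<lambda>i. f i k)) \<longleftrightarrow> (\<forall>i \<in> {1..N}. l1_seq (m i) (f i))"
proof -
  have idx: "stack N (\<lambda>i. f i k) $ (offset m i + b) = f i k $ b" if "i \<in> {1..N}" "b < m i" for i b k
    using stack_index[of N "\<lambda>i. f i k" m, OF c that] .
  show ?thesis
  proof (intro iffI ballI l1_seqI)
    fix i b assume "l1_seq (offset m (Suc N)) (\<lambda>k. stack N (\<lambda>i. f i k))" and i: "i \<in> {1..N}" and b: "b < m i"
    from l1_seq_summable[OF this(1) offset_add_less[of i N b m, OF i b]]
    show "summable (\<lambda>k. \<bar>f i k $ b\<bar>)" by (simp add: idx[OF i b])
  next
    fix a assume l1: "\<forall>i \<in> {1..N}. l1_seq (m i) (f i)" and "a < offset m (Suc N)"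
    then obtain i b where ib: "i \<in> {1..N}" "b < m i" "a = offset m i + b"
      using offset_cases by blast
    then show "summable (\<lambda>k. \<bar>stack N (\<lambda>i. f i k) $ a\<bar>)"
      using l1 l1_seq_summable[of "m i" "f i" b] by (simp add: idx)
  qed (use c in \<open>auto intro: stack_carrier\<close>)
qed

text \<open>The second factor tends to \<open>0\<close>, so it is eventually below \<open>1\<close>
  in absolute value and the first factor dominates the product.\<close>

lemma l1_seq_summable_mult:
  assumes "l1_seq n z" "l1_seq m w" "a < n" "b < m"
  shows "summable (\<lambda>k. z k $ a * w k $ b)"
proof -
  have "(\<lambda>k. \<bar>w k $ b\<bar>) \<longlonglongrightarrow> 0" using l1_seq_summable[OF assms(2,4)] by (rule summable_LIMSEQ_zero)
  then have "eventually (\<lambda>k. \<bar>w k $ b\<bar> < 1) sequentially" by (rule order_tendstoD) simp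
  then have "eventually (\<lambda>k. norm (z k $ a * w k $ b) \<le> \<bar>z k $ a\<bar>) sequentially"
    by eventually_elim (simp add: abs_mult mult_left_le)
  then show ?thesis using l1_seq_summable[OF assms(1,3)] by (rule summable_comparison_test_ev)
qed

lemma l1_seq_summable_quadratic:
  assumes M: "M \<in> carrier_mat n n" and z: "l1_seq n z"
  shows "summable (\<lambda>k. z k \<bullet> (M *\<^sub>v z k))"
proof -
  have "z k \<bullet> (M *\<^sub>v z k) = (\<Sum>a<n. z k $ a * (M *\<^sub>v z k) $ a)" for k
    using M l1_seq_carrier[OF z, of k] by (auto simp: scalar_prod_def[of _ "M *\<^sub>v z k"] lessThan_atLeast0 intro!: sum.cong)
  then show ?thesis
    using z l1_seq_mult_mat[OF M z] by (simp only:) (intro summable_sum l1_seq_summable_mult, auto)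
qed

lemma vec_norm2_tendsto_0:
  assumes z: "\<And>k. z k \<in> carrier_vec n" and "\<And>a. a < n \<Longrightarrow> (\<lambda>k. z k $ a) \<longlonglongrightarrow> 0"
  shows "(\<lambda>k. vec_norm2 (z k)) \<longlonglongrightarrow> 0"
proof -
  have "vec_norm2 (z k) = sqrt (\<Sum>a<n. z k $ a * z k $ a)" for k
    using z[of k] by (simp add: vec_norm2_def scalar_prod_def lessThan_atLeast0)
  moreover have "(\<lambda>k. sqrt (\<Sum>a<n. z k $ a * z k $ a)) \<longlonglongrightarrow> sqrt (\<Sum>a<n. 0 * 0)"
    using assms(2) by (intro tendsto_real_sqrt tendsto_sum tendsto_mult) auto
  ultimately show ?thesis by simp
qed

lemma l1_seq_tendsto_0: "l1_seq n z \<Longrightarrow> a < n \<Longrightarrow> (\<lambda>k. z k $ a) \<longlonglongrightarrow> 0"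
  using summable_LIMSEQ_zero[OF l1_seq_summable] tendsto_rabs_zero_iff by blast

lemma l1_seq_norm_tendsto_0: "l1_seq n z \<Longrightarrow> (\<lambda>k. vec_norm2 (z k)) \<longlonglongrightarrow> 0"
  by (rule vec_norm2_tendsto_0[of _ n]) (auto simp: l1_seq_carrier l1_seq_tendsto_0)

text \<open>By variation of constants the orbit is a convolution of the geometrically decaying powers of
  \<open>M\<close> with a summable sequence.\<close>

lemma stable_recursion_l1:
  assumes M: "M \<in> carrier_mat n n" and n: "n > 0" and stable: "stable_mat M"
    and z0: "z 0 \<in> carrier_vec n" and d: "l1_seq n d"
    and rec: "\<And>k. z (Suc k) = M *\<^sub>v z k + d k"
  shows "l1_seq n z"
proof -
  obtain \<rho> c where \<rho>: "0 < \<rho>" "\<rho> < 1"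
    and bound: "\<forall>k. \<forall>i<n. \<forall>j<n. \<bar>(M ^\<^sub>m k) $$ (i, j)\<bar> \<le> c * \<rho> ^ k"
    using stable_mat_power_bound[OF M n stable] .
  have Mp: "M ^\<^sub>m p \<in> carrier_mat n n" for p using M by (rule pow_carrier_mat)
  have dc: "d k \<in> carrier_vec n" for k using d by (rule l1_seq_carrier)
  have zc: "z k \<in> carrier_vec n" for k
    by (induction k) (use z0 M dc in \<open>auto simp: rec\<close>)
  have apply_bound: "\<bar>(M ^\<^sub>m p *\<^sub>v v) $ a\<bar> \<le> c * \<rho> ^ p * (\<Sum>b<n. \<bar>v $ b\<bar>)"
    if "v \<in> carrier_vec n" "a < n" for p v a
  proof -
    have "\<bar>(M ^\<^sub>m p *\<^sub>v v) $ a\<bar> \<le> (\<Sum>b<n. \<bar>(M ^\<^sub>m p) $$ (a, b)\<bar> * \<bar>v $ b\<bar>)"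
      unfolding mult_mat_vec_index[OF Mp that] by (rule order_trans[OF sum_abs]) (simp add: abs_mult)
    also have "\<dots> \<le> (\<Sum>b<n. c * \<rho> ^ p * \<bar>v $ b\<bar>)"
      using that bound by (intro sum_mono mult_right_mono) auto
    finally show ?thesis by (simp add: sum_distrib_left)
  qed
  \<comment> \<open>The extra power \<open>p\<close> in front makes the induction on
    \<open>k\<close> go through, each step moving one factor \<open>M\<close> into it; only
    \<open>p = 0\<close> is used afterwards. Since \<open>j < k\<close>, the subtraction in the
    exponent never truncates.\<close>
  have var_const: "(M ^\<^sub>m p *\<^sub>v z k) $ a =
      (M ^\<^sub>m (p + k) *\<^sub>v z 0) $ a + (\<Sum>j<k. (M ^\<^sub>m (p + k - Suc j) *\<^sub>v d j) $ a)" if a: "a < n" for p k a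
  proof (induction k arbitrary: p)
    case (Suc k)
    have "M ^\<^sub>m p *\<^sub>v z (Suc k) = M ^\<^sub>m p *\<^sub>v (M *\<^sub>v z k) + M ^\<^sub>m p *\<^sub>v d k"
      unfolding rec using Mp[of p] M zc[of k] dc by (intro mult_add_distrib_mat_vec) auto
    also have "M ^\<^sub>m p *\<^sub>v (M *\<^sub>v z k) = M ^\<^sub>m Suc p *\<^sub>v z k"
      using assoc_mult_mat_vec[OF Mp[of p] M zc[of k]] by simp
    finally have "(M ^\<^sub>m p *\<^sub>v z (Suc k)) $ a = (M ^\<^sub>m Suc p *\<^sub>v z k) $ a + (M ^\<^sub>m p *\<^sub>v d k) $ a"
      using a M by simp
    then show ?case unfolding Suc.IH by simp
  qed simp
  define D where "D k = (\<Sum>b<n. \<bar>d k $ b\<bar>)" for k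
  have "summable D" unfolding D_def using d by (intro summable_sum l1_seq_summable) auto
  moreover have "D k \<ge> 0" for k by (simp add: D_def sum_nonneg)
  \<comment> \<open>Cauchy product of the summable disturbance sizes with a geometric
    series.\<close>
  ultimately have conv: "summable (\<lambda>k. \<Sum>j\<le>k. D j * (c * \<rho> ^ (k - j)))"
    using \<rho> by (intro summable_Cauchy_product) (auto simp: abs_mult power_abs intro!: summable_mult)
  show ?thesis
  proof (rule l1_seqI[OF zc])
    fix a assume a: "a < n"
    let ?Z = "\<Sum>b<n. \<bar>z 0 $ b\<bar>"
    \<comment> \<open>Taken at \<open>Suc k\<close> because that state has seen exactly the
      disturbances \<open>0\<close> to \<open>k\<close>, which matches the index range of the Cauchy
      product.\<close>
    have "norm \<bar>z (Suc k) $ a\<bar> \<le> c * \<rho> ^ Suc k * ?Z + (\<Sum>j\<le>k. D j * (c * \<rho> ^ (k - j)))" for k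
    proof -
      have "z (Suc k) $ a = (M ^\<^sub>m Suc k *\<^sub>v z 0) $ a + (\<Sum>j\<le>k. (M ^\<^sub>m (k - j) *\<^sub>v d j) $ a)"
        using var_const[OF a, of 0 "Suc k"] zc[of "Suc k"] M by (simp add: lessThan_Suc_atMost)
      moreover have l: "\<bar>(M ^\<^sub>m Suc k *\<^sub>v z 0) $ a\<bar> \<le> c * \<rho> ^ Suc k * ?Z"
        using z0 a by (rule apply_bound)
      moreover have r: "\<bar>\<Sum>j\<le>k. (M ^\<^sub>m (k - j) *\<^sub>v d j) $ a\<bar> \<le> (\<Sum>j\<le>k. D j * (c * \<rho> ^ (k - j)))"
        using apply_bound[OF dc a]
        by (intro order_trans[OF sum_abs] sum_mono) (simp add: D_def mult.commute)
      ultimately show ?thesis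
        unfolding real_norm_def abs_idempotent
        by (simp only: order_trans[OF abs_triangle_ineq add_mono[OF l r]])
    qed
    moreover have "summable (\<lambda>k. c * \<rho> ^ Suc k * ?Z + (\<Sum>j\<le>k. D j * (c * \<rho> ^ (k - j))))"
      using \<rho> conv by (intro summable_add summable_mult summable_mult2) (auto intro!: summable_mult)
    ultimately have "summable (\<lambda>k. \<bar>z (Suc k) $ a\<bar>)"
      by (rule summable_comparison_test'[where N = 0, rotated])
    then show "summable (\<lambda>k. \<bar>z k $ a\<bar>)" by (rule summable_Suc_iff[THEN iffD1])
  qed
qed

lemma suminf_tail_tendsto_0:
  fixes f :: "nat \<Rightarrow> real"
  assumes "summable f"
  shows "(\<lambda>s. \<Sum>k. f (s + k)) \<longlonglongrightarrow> 0"
proof (rule LIMSEQ_I)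
  fix e :: real assume "0 < e"
  then show "\<exists>s0. \<forall>s\<ge>s0. norm ((\<Sum>k. f (s + k)) - 0) < e"
    using suminf_exist_split[OF _ assms] by (simp add: add.commute)
qed

text \<open>The span of the real and imaginary parts \<open>a\<close>, \<open>b\<close> of an eigenvector for \<open>\<lambda>\<close> is invariant, and
  \<open>a \<bullet> P a + b \<bullet> P b\<close> is multiplied by \<open>\<bar>\<lambda>\<bar>\<^sup>2\<close> in each step.\<close>

lemma stable_mat_quadratic_decay:
  assumes M: "M \<in> carrier_mat n n" and n: "n > 0" and P: "pos_def_mat n P"
    and decay: "\<And>z. z 0 \<in> carrier_vec n \<Longrightarrow> (\<And>k. z (Suc k) = M *\<^sub>v z k) \<Longrightarrow>
      (\<lambda>k. z k \<bullet> (P *\<^sub>v z k)) \<longlonglongrightarrow> 0"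
  shows "stable_mat M"
proof (rule ccontr)
  let ?M = "map_mat complex_of_real M"
  assume "\<not> stable_mat M"
  moreover have "spectral_radius ?M \<in> norm ` spectrum ?M"
    using M n by (intro spectral_radius_mem_max) auto
  ultimately obtain \<mu> v where \<mu>: "norm \<mu> \<ge> 1" and v: "eigenvector ?M v \<mu>"
    by (auto simp: stable_mat_def spectrum_def eigenvalue_def not_less)
  have vc: "v \<in> carrier_vec n" and v0: "v \<noteq> 0\<^sub>v n" and Mv: "?M *\<^sub>v v = \<mu> \<cdot>\<^sub>v v"
    using v M by (auto simp: eigenvector_def)
  have Pc: "P \<in> carrier_mat n n" and Pt: "P\<^sup>T = P"
    and Ppos: "\<And>w. w \<in> carrier_vec n \<Longrightarrow> w \<noteq> 0\<^sub>v n \<Longrightarrow> 0 < w \<bullet> (P *\<^sub>v w)"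
    using P by (auto simp: pos_def_mat_def)
  define V where "V w = w \<bullet> (P *\<^sub>v w)" for w
  define \<alpha> \<beta> where "\<alpha> = Re \<mu>" and "\<beta> = Im \<mu>"
  define a where "a k = ((*\<^sub>v) M ^^ k) (map_vec Re v)" for k
  define b where "b k = ((*\<^sub>v) M ^^ k) (map_vec Im v)" for k
  have ac: "a k \<in> carrier_vec n" and bc: "b k \<in> carrier_vec n" for k
    by (induction k) (use vc M in \<open>auto simp: a_def b_def\<close>)
  have step: "a (Suc k) = M *\<^sub>v a k" "b (Suc k) = M *\<^sub>v b k" for k
    by (simp_all add: a_def b_def)
  have re: "(M *\<^sub>v map_vec Re v) $ i = \<alpha> * Re (v $ i) - \<beta> * Im (v $ i)"
    and im: "(M *\<^sub>v map_vec Im v) $ i = \<beta> * Re (v $ i) + \<alpha> * Im (v $ i)" if i: "i < n" for i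
  proof -
    have "(?M *\<^sub>v v) $ i = (\<Sum>c<n. complex_of_real (M $$ (i, c)) * v $ c)"
      using mult_mat_vec_index[OF _ vc i, of ?M] M i by simp
    then have eq: "(\<Sum>c<n. complex_of_real (M $$ (i, c)) * v $ c) = \<mu> * v $ i"
      using Mv vc i by simp
    show "(M *\<^sub>v map_vec Re v) $ i = \<alpha> * Re (v $ i) - \<beta> * Im (v $ i)"
      using arg_cong[OF eq, of Re] mult_mat_vec_index[OF M _ i, of "map_vec Re v"] vc
      by (simp add: \<alpha>_def \<beta>_def)
    show "(M *\<^sub>v map_vec Im v) $ i = \<beta> * Re (v $ i) + \<alpha> * Im (v $ i)"
      using arg_cong[OF eq, of Im] mult_mat_vec_index[OF M _ i, of "map_vec Im v"] vc
      by (simp add: \<alpha>_def \<beta>_def)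
  qed
  \<comment> \<open>For \<open>k = 0\<close> these are the real and imaginary parts of the
    eigenvector equation; being linear relations, they are preserved when \<open>M\<close> is
    applied.\<close>
  have rot: "M *\<^sub>v a k = \<alpha> \<cdot>\<^sub>v a k - \<beta> \<cdot>\<^sub>v b k \<and> M *\<^sub>v b k = \<beta> \<cdot>\<^sub>v a k + \<alpha> \<cdot>\<^sub>v b k" for k
  proof (induction k)
    case 0
    show ?case using re im vc M by (auto simp: a_def b_def intro!: eq_vecI)
  next
    case (Suc k)
    have "M *\<^sub>v (\<alpha> \<cdot>\<^sub>v a k - \<beta> \<cdot>\<^sub>v b k) = \<alpha> \<cdot>\<^sub>v (M *\<^sub>v a k) - \<beta> \<cdot>\<^sub>v (M *\<^sub>v b k)"
      using ac bc by (simp add: mult_minus_distrib_mat_vec[OF M] mult_mat_vec[OF M])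
    moreover have "M *\<^sub>v (\<beta> \<cdot>\<^sub>v a k + \<alpha> \<cdot>\<^sub>v b k) = \<beta> \<cdot>\<^sub>v (M *\<^sub>v a k) + \<alpha> \<cdot>\<^sub>v (M *\<^sub>v b k)"
      using ac bc by (simp add: mult_add_distrib_mat_vec[OF M] mult_mat_vec[OF M])
    ultimately show ?case using Suc.IH by (metis step)
  qed
  \<comment> \<open>The mixed terms are equal by symmetry of \<open>P\<close> and enter the two
    forms with opposite signs. They cancel only in the sum, which is why the two orbits are measured
    together.\<close>
  have grow: "V (a (Suc k)) + V (b (Suc k)) = (norm \<mu>)\<^sup>2 * (V (a k) + V (b k))" for k
  proof -
    let ?a = "a k" and ?b = "b k"
    have Pa: "P *\<^sub>v ?a \<in> carrier_vec n" and Pb: "P *\<^sub>v ?b \<in> carrier_vec n"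
      using Pc ac bc by (auto intro!: mult_mat_vec_carrier)
    have ab: "?b \<bullet> (P *\<^sub>v ?a) = ?a \<bullet> (P *\<^sub>v ?b)"
      using transpose_vec_mult_scalar[OF Pc ac bc] Pt comm_scalar_prod[OF Pb ac] by metis
    have "V (\<alpha> \<cdot>\<^sub>v ?a - \<beta> \<cdot>\<^sub>v ?b) = \<alpha>\<^sup>2 * V ?a - 2 * \<alpha> * \<beta> * (?a \<bullet> (P *\<^sub>v ?b)) + \<beta>\<^sup>2 * V ?b"
      unfolding V_def using ac[of k] bc[of k] Pa Pb
      by (simp add: mult_minus_distrib_mat_vec[OF Pc] mult_mat_vec[OF Pc]
          minus_scalar_prod_distrib[of _ n] scalar_prod_minus_distrib[of _ n] ab power2_eq_square algebra_simps)
    moreover have "V (\<beta> \<cdot>\<^sub>v ?a + \<alpha> \<cdot>\<^sub>v ?b) = \<beta>\<^sup>2 * V ?a + 2 * \<alpha> * \<beta> * (?a \<bullet> (P *\<^sub>v ?b)) + \<alpha>\<^sup>2 * V ?b"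
      unfolding V_def using ac[of k] bc[of k] Pa Pb
      by (simp add: mult_add_distrib_mat_vec[OF Pc] mult_mat_vec[OF Pc]
          add_scalar_prod_distrib[of _ n] scalar_prod_add_distrib[of _ n] ab power2_eq_square algebra_simps)
    ultimately have "V (a (Suc k)) + V (b (Suc k)) = (\<alpha>\<^sup>2 + \<beta>\<^sup>2) * (V ?a + V ?b)"
      using rot by (simp add: step algebra_simps)
    then show ?thesis by (simp add: \<alpha>_def \<beta>_def cmod_power2)
  qed
  have nonneg: "0 \<le> V w" if "w \<in> carrier_vec n" for w
    using Ppos[OF that] Pc that by (cases "w = 0\<^sub>v n") (auto simp: V_def less_imp_le)
  have "map_vec Re v \<noteq> 0\<^sub>v n \<or> map_vec Im v \<noteq> 0\<^sub>v n"
  proof (rule ccontr)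
    assume neg: "\<not> ?thesis"
    have "v $ i = 0" if i: "i < n" for i
    proof -
      have "Re (v $ i) = map_vec Re v $ i" "Im (v $ i) = map_vec Im v $ i" using i vc by auto
      then show ?thesis using neg i by (simp add: complex_eq_iff)
    qed
    then have "v = 0\<^sub>v n" using vc by (intro eq_vecI) auto
    then show False using v0 by simp
  qed
  then have "0 < V (a 0) \<or> 0 < V (b 0)"
    using Ppos vc by (auto simp: V_def a_def b_def)
  then have pos: "0 < V (a 0) + V (b 0)"
    using nonneg[OF ac[of 0]] nonneg[OF bc[of 0]] by linarith
  have "V (a 0) + V (b 0) \<le> V (a k) + V (b k)" for k
  proof (induction k)
    case (Suc k)
    have "1 * (V (a k) + V (b k)) \<le> (norm \<mu>)\<^sup>2 * (V (a k) + V (b k))"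
      using \<mu> nonneg[OF ac[of k]] nonneg[OF bc[of k]] by (intro mult_right_mono) auto
    then show ?case using Suc.IH unfolding grow[of k] mult_1 by (rule order_trans[rotated])
  qed simp
  \<comment> \<open>The sum never falls below its positive initial value, as \<mu> has modulus at
    least \<open>1\<close>, yet each of its two terms decays by assumption.\<close>
  moreover have "(\<lambda>k. V (a k) + V (b k)) \<longlonglongrightarrow> 0 + 0"
    unfolding V_def using ac bc step by (intro tendsto_add decay) auto
  ultimately have "V (a 0) + V (b 0) \<le> 0 + 0"
    by (intro LIMSEQ_le_const) auto
  then show False using pos by simp
qed

subsection \<open>Feedforward cancellation\<close>

lemma cols_subset_mat_range:
  assumes "set cs \<subseteq> carrier_vec q"
  shows "set cs \<subseteq> mat_range (mat_of_cols q cs)"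
proof
  fix c assume "c \<in> set cs"
  then obtain j where j: "j < length cs" "c = cs ! j" by (auto simp: in_set_conv_nth)
  then have "mat_of_cols q cs *\<^sub>v unit_vec (length cs) j = c"
    using assms nth_mem[OF j(1)] by (subst mult_mat_unit_vec[of _ q]) (auto intro!: col_mat_of_cols)
  then show "c \<in> mat_range (mat_of_cols q cs)"
    unfolding mat_range_def by (intro image_eqI[of _ _ "unit_vec (length cs) j"]) auto
qed

text \<open>By \<open>D * H * D = D\<close>, the matrix \<open>D * H\<close> fixes every vector in
  the range of \<open>D\<close>, in particular each column of \<open>X\<close>.\<close>

lemma moore_penrose_projection:
  assumes D: "D \<in> carrier_mat q m" and H: "is_moore_penrose D H" and X: "X \<in> carrier_mat q p"
    and range: "set (cols X) \<subseteq> mat_range D"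
  shows "D * (H * X) = X"
proof (rule mat_col_eqI)
  have Hc: "H \<in> carrier_mat m q" and DHD: "D * H * D = D"
    using H D by (auto simp: is_moore_penrose_def)
  fix j assume "j < dim_col X"
  then have j: "j < p" using X by simp
  then have "col X j \<in> mat_range D" using X range by (auto simp: cols_def)
  then obtain w where w: "w \<in> carrier_vec m" "col X j = D *\<^sub>v w" using D by (auto simp: mat_range_def)
  have "col (D * (H * X)) j = (D * H) *\<^sub>v col X j"
    using col_mult2[OF D mult_carrier_mat[OF Hc X] j] col_mult2[OF Hc X j]
      assoc_mult_mat_vec[OF D Hc, of "col X j"] X j by (simp del: col_mult)
  also have "\<dots> = (D * H * D) *\<^sub>v w"
    unfolding w(2) using D Hc w(1) by (intro assoc_mult_mat_vec[symmetric, of _ q q _ m]) auto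
  finally show "col (D * (H * X)) j = col X j" by (simp add: DHD w(2))
qed (use D X in auto)

text \<open>A sum of vectors takes its dimension from the last summand, here a product with
  \<open>H\<close> in front, so the shape of \<open>H\<close> decides.\<close>

lemma feedforward_carrier:
  assumes "H \<in> carrier_mat m q"
  shows "feedforward G H A A' B' C' x x' u' \<in> carrier_vec m"
  using assms by (intro carrier_vecI) (simp add: feedforward_def)

text \<open>The three cancellation identities isolate what the two feedforward cases have in common.
  They make \<open>C * B\<close> times the feedforward equal to the increment of the parent's output
  minus the drift of the follower's own output, and the difference of the next outputs
  collapses.\<close>

lemma feedforward_error_step:
  assumes A: "A \<in> carrier_mat n n" and B: "B \<in> carrier_mat n m" and C: "C \<in> carrier_mat q n"
    and A': "A' \<in> carrier_mat n' n'" and B': "B' \<in> carrier_mat n' m'" and C': "C' \<in> carrier_mat q n'"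
    and G: "G \<in> carrier_mat m n" and H: "H \<in> carrier_mat m q"
    and cancel: "C * B * G * (A - 1\<^sub>m n) = C * (A - 1\<^sub>m n)"
      "C * B * (H * (C' * B')) = C' * B'" "C * B * (H * (C' * (A' - 1\<^sub>m n'))) = C' * (A' - 1\<^sub>m n')"
    and x: "x \<in> carrier_vec n" and x': "x' \<in> carrier_vec n'" and u': "u' \<in> carrier_vec m'"
    and v: "v \<in> carrier_vec m"
  shows "C *\<^sub>v (A *\<^sub>v x + B *\<^sub>v (feedforward G H A A' B' C' x x' u' + v)) - C' *\<^sub>v (A' *\<^sub>v x' + B' *\<^sub>v u')
    = (C *\<^sub>v x - C' *\<^sub>v x') + C * B *\<^sub>v v"
proof -
  let ?w = "feedforward G H A A' B' C' x x' u'"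
  have D: "C * B \<in> carrier_mat q m" using C B by simp
  have A1: "A - 1\<^sub>m n \<in> carrier_mat n n" and A1': "A' - 1\<^sub>m n' \<in> carrier_mat n' n'"
    using A A' by (auto intro: carrier_matI)
  have wc: "?w \<in> carrier_vec m" using H by (rule feedforward_carrier)
  have c1: "G * (A - 1\<^sub>m n) \<in> carrier_mat m n" using G A1 by simp
  have c2: "H * (C' * B') \<in> carrier_mat m m'" using H C' B' by simp
  have c3: "H * (C' * (A' - 1\<^sub>m n')) \<in> carrier_mat m n'" using H C' A1' by simp
  have w: "?w = - (G * (A - 1\<^sub>m n) *\<^sub>v x) + H * (C' * B') *\<^sub>v u' + H * (C' * (A' - 1\<^sub>m n')) *\<^sub>v x'"
    unfolding feedforward_def using A A' assoc_mult_mat[OF H C' A1'] by simp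
  have "C * B *\<^sub>v ?w = - (C * B *\<^sub>v (G * (A - 1\<^sub>m n) *\<^sub>v x)) + C * B *\<^sub>v (H * (C' * B') *\<^sub>v u')
      + C * B *\<^sub>v (H * (C' * (A' - 1\<^sub>m n')) *\<^sub>v x')"
  proof -
    have n: "C * B *\<^sub>v (- y) = - (C * B *\<^sub>v y)" if "y \<in> carrier_vec m" for y
      using D that by (intro eq_vecI) auto
    show ?thesis
      unfolding w
      using mult_mat_vec_carrier[OF c1 x] mult_mat_vec_carrier[OF c2 u'] mult_mat_vec_carrier[OF c3 x']
        mult_mat_vec_carrier[OF D mult_mat_vec_carrier[OF c1 x]]
        mult_mat_vec_carrier[OF D mult_mat_vec_carrier[OF c2 u']]
        mult_mat_vec_carrier[OF D mult_mat_vec_carrier[OF c3 x']]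
      by (simp add: mult_add_distrib_mat_vec[OF D] n)
  qed
  also have "C * B *\<^sub>v (G * (A - 1\<^sub>m n) *\<^sub>v x) = C * (A - 1\<^sub>m n) *\<^sub>v x"
    using assoc_mult_mat_vec[OF D c1 x] assoc_mult_mat[OF D G A1] cancel(1) by simp
  also have "C * B *\<^sub>v (H * (C' * B') *\<^sub>v u') = C' * B' *\<^sub>v u'"
    using assoc_mult_mat_vec[OF D c2 u'] cancel(2) by simp
  also have "C * B *\<^sub>v (H * (C' * (A' - 1\<^sub>m n')) *\<^sub>v x') = C' * (A' - 1\<^sub>m n') *\<^sub>v x'"
    using assoc_mult_mat_vec[OF D c3 x'] cancel(3) by simp
  also have "C * (A - 1\<^sub>m n) *\<^sub>v x = C *\<^sub>v (A *\<^sub>v x) - C *\<^sub>v x"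
    using A C A1 x by (simp add: assoc_mult_mat_vec[OF C A1 x] minus_mult_distrib_mat_vec[OF A]
        mult_minus_distrib_mat_vec[OF C mult_mat_vec_carrier[OF A x] x])
  also have "C' * (A' - 1\<^sub>m n') *\<^sub>v x' = C' *\<^sub>v (A' *\<^sub>v x') - C' *\<^sub>v x'"
    using A' C' A1' x' by (simp add: assoc_mult_mat_vec[OF C' A1' x'] minus_mult_distrib_mat_vec[OF A']
        mult_minus_distrib_mat_vec[OF C' mult_mat_vec_carrier[OF A' x'] x'])
  finally have Dw: "C * B *\<^sub>v ?w = - (C *\<^sub>v (A *\<^sub>v x) - C *\<^sub>v x) + C' * B' *\<^sub>v u'
      + (C' *\<^sub>v (A' *\<^sub>v x') - C' *\<^sub>v x')" .
  have wv: "?w + v \<in> carrier_vec m" using wc v by simp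
  have 1: "C *\<^sub>v (A *\<^sub>v x + B *\<^sub>v (?w + v)) = C *\<^sub>v (A *\<^sub>v x) + (C * B *\<^sub>v ?w + C * B *\<^sub>v v)"
    using mult_add_distrib_mat_vec[OF C mult_mat_vec_carrier[OF A x] mult_mat_vec_carrier[OF B wv]]
      assoc_mult_mat_vec[OF C B wv] mult_add_distrib_mat_vec[OF D wc v] by simp
  have 2: "C' *\<^sub>v (A' *\<^sub>v x' + B' *\<^sub>v u') = C' *\<^sub>v (A' *\<^sub>v x') + C' * B' *\<^sub>v u'"
    using mult_add_distrib_mat_vec[OF C' mult_mat_vec_carrier[OF A' x'] mult_mat_vec_carrier[OF B' u']]
      assoc_mult_mat_vec[OF C' B' u'] by simp
  have arith: "p + (- (p - r) + s + (p' - r') + t) - (p' + s) = (r - r') + t"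
    if "p \<in> carrier_vec q" "r \<in> carrier_vec q" "s \<in> carrier_vec q" "p' \<in> carrier_vec q"
      "r' \<in> carrier_vec q" "t \<in> carrier_vec q" for p r s p' r' t :: "real vec"
    using that by (intro eq_vecI) auto
  show ?thesis
    unfolding 1 2 Dw
    using mult_mat_vec_carrier[OF C mult_mat_vec_carrier[OF A x]] mult_mat_vec_carrier[OF C x]
      mult_mat_vec_carrier[OF mult_carrier_mat[OF C' B'] u']
      mult_mat_vec_carrier[OF C' mult_mat_vec_carrier[OF A' x']] mult_mat_vec_carrier[OF C' x']
      mult_mat_vec_carrier[OF D v]
    by (rule arith)
qed

text \<open>With genuine inverses, \<open>C * B * G = C\<close> and \<open>C * B * H\<close> is the
  identity. With pseudoinverses, the first identity is the second conjunct of
  \<open>ff_case2\<close>, and the other two hold because the range inclusion puts all columns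
  involved into the range of \<open>C * B\<close>, where \<open>C * B * H\<close> acts as the
  identity.\<close>

lemma feedforward_cancels:
  assumes A: "A \<in> carrier_mat n n" and B: "B \<in> carrier_mat n m" and C: "C \<in> carrier_mat q n"
    and A': "A' \<in> carrier_mat n' n'" and B': "B' \<in> carrier_mat n' m'" and C': "C' \<in> carrier_mat q n'"
    and ff: "ff_case1 B C \<and> G = minv B \<and> H = minv (C * B) \<or>
      ff_case2 A B C A' B' C' \<and> G = pinv B \<and> H = pinv (C * B)"
  shows "G \<in> carrier_mat m n" "H \<in> carrier_mat m q"
    "C * B * G * (A - 1\<^sub>m n) = C * (A - 1\<^sub>m n)"
    "C * B * (H * (C' * B')) = C' * B'" "C * B * (H * (C' * (A' - 1\<^sub>m n'))) = C' * (A' - 1\<^sub>m n')"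
proof -
  have D: "C * B \<in> carrier_mat q m" using C B by simp
  have A1: "A - 1\<^sub>m n \<in> carrier_mat n n" and A1': "A' - 1\<^sub>m n' \<in> carrier_mat n' n'"
    using A A' by (auto intro: carrier_matI)
  have CB': "C' * B' \<in> carrier_mat q m'" and CA': "C' * (A' - 1\<^sub>m n') \<in> carrier_mat q n'"
    and CA: "C * (A - 1\<^sub>m n) \<in> carrier_mat q n"
    using B' C' A1' C A1 by auto
  consider (inv) "ff_case1 B C" "G = minv B" "H = minv (C * B)"
    | (pinv) "ff_case2 A B C A' B' C'" "G = pinv B" "H = pinv (C * B)"
    using ff by blast
  then have "G \<in> carrier_mat m n \<and> H \<in> carrier_mat m q \<and>
    C * B * G * (A - 1\<^sub>m n) = C * (A - 1\<^sub>m n) \<and>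
    C * B * (H * (C' * B')) = C' * B' \<and> C * B * (H * (C' * (A' - 1\<^sub>m n'))) = C' * (A' - 1\<^sub>m n')"
  proof cases
    case inv
    then have inv': "invertible_mat (C * B)" "invertible_mat B" by (auto simp: ff_case1_def)
    \<comment> \<open>Invertible matrices are square, so state, input and output dimensions coincide
      here.\<close>
    then have dims: "n = m" "q = m" using B D by (auto simp: invertible_mat_def)
    have G: "G \<in> carrier_mat m m" "B * G = 1\<^sub>m m"
      using minv_inverse[OF _ inv'(2), of m] B inv(2) by (auto simp: dims)
    have H: "H \<in> carrier_mat m m" "C * B * H = 1\<^sub>m m"
      using minv_inverse[OF _ inv'(1), of m] D inv(3) by (auto simp: dims)
    have "C * B * G = C" using assoc_mult_mat[of C m m B m G m] C B G by (simp add: dims)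
    moreover have "C * B * (H * X) = X" if "X \<in> carrier_mat m p" for X p
      using assoc_mult_mat[of "C * B" m m H m X p] D H that by (simp add: dims)
    ultimately show ?thesis using G H CB' CA' by (auto simp: dims)
  next
    case pinv
    have G: "G \<in> carrier_mat m n" and Hmp: "is_moore_penrose (C * B) H"
      using is_moore_penrose_pinv[of B] is_moore_penrose_pinv[of "C * B"] B pinv
      by (auto simp: is_moore_penrose_def)
    have H: "H \<in> carrier_mat m q" using Hmp B C by (auto simp: is_moore_penrose_def)
    let ?cs = "cols (- (C * (A - 1\<^sub>m n))) @ cols (C' * (A' - 1\<^sub>m n')) @ cols (C' * B')"
    have "set ?cs \<subseteq> carrier_vec q"
      using C C' cols_dim[of "- (C * (A - 1\<^sub>m n))"] cols_dim[of "C' * (A' - 1\<^sub>m n')"] cols_dim[of "C' * B'"]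
      by auto
    then have "set ?cs \<subseteq> mat_range (mat_of_cols q ?cs)" by (rule cols_subset_mat_range)
    also have "\<dots> \<subseteq> mat_range (C * B)"
      using pinv(1) A A' C by (simp add: ff_case2_def)
    finally have "set (cols (C' * (A' - 1\<^sub>m n'))) \<subseteq> mat_range (C * B)" "set (cols (C' * B')) \<subseteq> mat_range (C * B)"
      by simp_all
    then show ?thesis
      using moore_penrose_projection[OF D Hmp CA'] moore_penrose_projection[OF D Hmp CB'] G H pinv(1,2) A
      by (simp add: ff_case2_def)
  qed
  then show "G \<in> carrier_mat m n" "H \<in> carrier_mat m q"
    "C * B * G * (A - 1\<^sub>m n) = C * (A - 1\<^sub>m n)"
    "C * B * (H * (C' * B')) = C' * B'" "C * B * (H * (C' * (A' - 1\<^sub>m n'))) = C' * (A' - 1\<^sub>m n')"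
    by blast+
qed

subsection \<open>Linear quadratic control\<close>

lemma lq_gain_carrier:
  assumes "A \<in> carrier_mat n n" "B \<in> carrier_mat n m" "R \<in> carrier_mat m m" "P \<in> carrier_mat n n"
    "invertible_mat (R + B\<^sup>T * P * B)"
  shows "lq_gain A B R P \<in> carrier_mat m n"
proof -
  have "R + B\<^sup>T * P * B \<in> carrier_mat m m" using assms by simp
  then have "minv (R + B\<^sup>T * P * B) \<in> carrier_mat m m" using assms(5) by (rule minv_inverse)
  then show ?thesis unfolding lq_gain_def uminus_carrier_iff_mat
    using assms(1,2,4) by (intro mult_carrier_mat) auto
qed

text \<open>Along the optimal closed loop the value \<open>z \<bullet> P z\<close> is the tail of a convergent cost series.\<close>

lemma lq_optimal_stable:
  assumes A: "A \<in> carrier_mat n n" and B: "B \<in> carrier_mat n m" and K: "K \<in> carrier_mat m n"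
    and n: "n > 0" and P: "pos_def_mat n P" and opt: "lq_optimal A B Q R K P"
  shows "stable_mat (A + B * K)"
proof (rule stable_mat_quadratic_decay[OF _ n P])
  show M: "A + B * K \<in> carrier_mat n n" using A B K by simp
  fix z :: "nat \<Rightarrow> real vec"
  assume z0: "z 0 \<in> carrier_vec n" and step: "\<And>k. z (Suc k) = (A + B * K) *\<^sub>v z k"
  have zc: "z k \<in> carrier_vec n" for k
    using mult_mat_vec_carrier[OF M] z0 by (induction k) (auto simp: step)
  let ?f = "\<lambda>k. stage_cost Q R (z k) (K *\<^sub>v z k)"
  \<comment> \<open>\<open>lq_optimal\<close> speaks about time \<open>0\<close> only; since the
    closed loop is autonomous, every shifted orbit is again a trajectory, which gives the cost from
    any time \<open>s\<close>.\<close>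
  have traj: "lin_trajectory A B (\<lambda>k. z (s + k)) (\<lambda>k. K *\<^sub>v z (s + k))" for s
  proof -
    have "z (Suc k) = A *\<^sub>v z k + B *\<^sub>v (K *\<^sub>v z k)" for k
      unfolding step using add_mult_distrib_mat_vec[OF A mult_carrier_mat[OF B K] zc]
        assoc_mult_mat_vec[OF B K zc] by simp
    then show ?thesis using A B zc mult_mat_vec_carrier[OF K zc] by (simp add: lin_trajectory_def)
  qed
  have "finite_cost Q R (\<lambda>k. z (s + k)) (\<lambda>k. K *\<^sub>v z (s + k)) 0 \<and>
      lq_cost Q R (\<lambda>k. z (s + k)) (\<lambda>k. K *\<^sub>v z (s + k)) 0 = z s \<bullet> (P *\<^sub>v z s)" for s
    using opt[unfolded lq_optimal_def, THEN conjunct1, rule_format, of "\<lambda>k. z (s + k)" "\<lambda>k. K *\<^sub>v z (s + k)"]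
      traj[of s] by simp
  then have cost: "summable (\<lambda>k. ?f (s + k))" "(\<Sum>k. ?f (s + k)) = z s \<bullet> (P *\<^sub>v z s)" for s
    by (simp_all add: finite_cost_def lq_cost_def)
  show "(\<lambda>k. z k \<bullet> (P *\<^sub>v z k)) \<longlonglongrightarrow> 0"
    using suminf_tail_tendsto_0[of ?f] cost(1)[of 0] by (simp add: cost(2))
qed

subsection \<open>Consensus\<close>

lemma l1_seq_quadratic_tendsto_0:
  "M \<in> carrier_mat n n \<Longrightarrow> l1_seq n z \<Longrightarrow> (\<lambda>k. z k \<bullet> (M *\<^sub>v z k)) \<longlonglongrightarrow> 0"
  by (rule summable_LIMSEQ_zero[OF l1_seq_summable_quadratic])

text \<open>Turns the sum over agents inside an observer into the centralized term \<B> times \<K>: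
  a matrix product is the sum of block columns times block rows.\<close>

lemma block_col_row_sum:
  assumes B: "B \<in> carrier_mat d (offset m (Suc N))" and K: "K \<in> carrier_mat (offset m (Suc N)) d"
    and v: "v \<in> carrier_vec d" and a: "a < d"
  shows "(\<Sum>l\<in>{1..N}. (block_col m B l * block_row m K l *\<^sub>v v) $ a) = (B * K *\<^sub>v v) $ a"
proof -
  have Kv: "block_row m K l *\<^sub>v v \<in> carrier_vec (m l)" for l
    using block_row_carrier[OF K] v by (rule mult_mat_vec_carrier)
  have "B * K *\<^sub>v v = B *\<^sub>v stack N (\<lambda>l. block_row m K l *\<^sub>v v)"
    using assoc_mult_mat_vec[OF B K v] stack_block_row[OF K v] by simp
  also have "\<dots> = finsum_vec TYPE(real) d (\<lambda>l. block_col m B l *\<^sub>v (block_row m K l *\<^sub>v v)) {1..N}"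
    using B Kv by (rule mult_mat_stack)
  also have "\<dots> $ a = (\<Sum>l\<in>{1..N}. (block_col m B l *\<^sub>v (block_row m K l *\<^sub>v v)) $ a)"
    using a by (intro index_finsum_vec) (auto intro!: mult_mat_vec_carrier[OF block_col_carrier[OF B, of m] Kv])
  finally show ?thesis
    using assoc_mult_mat_vec[OF block_col_carrier[OF B, of m] block_row_carrier[OF K, of m] v] by simp
qed

theorem theorem3:
  fixes N q :: nat and n m r :: "nat \<Rightarrow> nat"
    and A B C :: "nat \<Rightarrow> real mat"
    and E :: "(nat \<times> nat) set" and par :: "nat \<Rightarrow> nat"
    and Q :: "real mat" and R F \<Phi> :: "nat \<Rightarrow> real mat"
    and \<A> \<B> \<Q> \<R> \<P> \<K> :: "real mat"
    and \<B>c \<K>r :: "nat \<Rightarrow> real mat"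
    and x y u u_ff u_fb \<Upsilon>hat :: "nat \<Rightarrow> nat \<Rightarrow> real vec"
    and \<Upsilon> ubar :: "nat \<Rightarrow> real vec"
  assumes N: "N \<ge> 1" and q: "q \<ge> 1"
    and A: "\<And>i. i \<in> {0..N} \<Longrightarrow> A i \<in> carrier_mat (n i) (n i)"
    and B: "\<And>i. i \<in> {1..N} \<Longrightarrow> B i \<in> carrier_mat (n i) (m i)"
    and C: "\<And>i. i \<in> {0..N} \<Longrightarrow> C i \<in> carrier_mat q (n i)"
    and B0: "B 0 = 0\<^sub>m (n 0) (m 0)"
    and graph: "E \<subseteq> {0..N} \<times> {0..N}"
    and tree: "spanning_tree_parent N E par"
    \<comment> \<open>weights, global error system, Riccati equation and gain\<close>
    and Q: "pos_semidef_mat q Q"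
    and R: "\<And>i. i \<in> {1..N} \<Longrightarrow> pos_def_mat (m i) (R i)"
    and calA: "\<A> = kron (1\<^sub>m N) (1\<^sub>m q)"
    and calB: "\<B> = block_diag N (\<lambda>i. C i * B i)"
    and calQ: "\<Q> = kron (1\<^sub>m N) Q"
    and calR: "\<R> = block_diag N R"
    and P: "\<P> \<in> carrier_mat (N * q) (N * q)" "\<P>\<^sup>T = \<P>"
    and invRB: "invertible_mat (\<R> + \<B>\<^sup>T * \<P> * \<B>)"
    and riccati: "riccati_solution \<A> \<B> \<Q> \<R> \<P>"
    and K: "\<K> = lq_gain \<A> \<B> \<R> \<P>"
    and Bc: "\<B>c = block_col m \<B>"
    and Kr: "\<K>r = block_row m \<K>"
    \<comment> \<open>measurements and observer gains\<close>
    and F: "\<And>i. i \<in> {1..N} \<Longrightarrow> zero_identity_blocks (r i) N q (F i)"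
    and Phi: "\<And>i. i \<in> {1..N} \<Longrightarrow> \<Phi> i \<in> carrier_mat (N * q) (r i * q)"
    and Hc: "stable_mat (block_mat N (N * q) (\<lambda>i l.
               if i = l then \<A> + \<B> * \<K> - \<B>c i * \<K>r i - \<Phi> i * F i else - (\<B>c l * \<K>r l)))"
    \<comment> \<open>closed loop, for arbitrary initial states of agents and observers\<close>
    and x_init: "\<And>i. i \<in> {0..N} \<Longrightarrow> x i 0 \<in> carrier_vec (n i)"
    and hat_init: "\<And>i. i \<in> {1..N} \<Longrightarrow> \<Upsilon>hat i 0 \<in> carrier_vec (N * q)"
    and leader: "\<And>k. x 0 (k + 1) = A 0 *\<^sub>v x 0 k"
    and u0: "\<And>k. u 0 k = 0\<^sub>v (m 0)"
    and follower: "\<And>i k. i \<in> {1..N} \<Longrightarrow> x i (k + 1) = A i *\<^sub>v x i k + B i *\<^sub>v u i k"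
    and outputs: "\<And>i k. i \<in> {0..N} \<Longrightarrow> y i k = C i *\<^sub>v x i k"
    and errors: "\<And>k. \<Upsilon> k = stack N (\<lambda>i. y i k - y (par i) k)"
    and control: "\<And>i k. i \<in> {1..N} \<Longrightarrow> u i k = u_ff i k + u_fb i k"
    and ff: "\<And>i. i \<in> {1..N} \<Longrightarrow>
         ff_case1 (B i) (C i) \<and>
         (\<forall>k. u_ff i k = feedforward (minv (B i)) (minv (C i * B i))
                 (A i) (A (par i)) (B (par i)) (C (par i)) (x i k) (x (par i) k) (u (par i) k))
       \<or> ff_case2 (A i) (B i) (C i) (A (par i)) (B (par i)) (C (par i)) \<and>
         (\<forall>k. u_ff i k = feedforward (pinv (B i)) (pinv (C i * B i))
                 (A i) (A (par i)) (B (par i)) (C (par i)) (x i k) (x (par i) k) (u (par i) k))"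
    and fb: "\<And>i k. i \<in> {1..N} \<Longrightarrow> u_fb i k = \<K>r i *\<^sub>v \<Upsilon>hat i k"
    and ubar: "\<And>k. ubar k = stack N (\<lambda>i. u_fb i k)"
    and observer: "\<And>i k. i \<in> {1..N} \<Longrightarrow>
         \<Upsilon>hat i (k + 1) = \<A> *\<^sub>v \<Upsilon>hat i k + \<B>c i *\<^sub>v u_fb i k
           + finsum_vec TYPE(real) (N * q) (\<lambda>l. \<B>c l * \<K>r l *\<^sub>v \<Upsilon>hat i k) ({1..N} - {i})
           + \<Phi> i *\<^sub>v (F i *\<^sub>v \<Upsilon> k - F i *\<^sub>v \<Upsilon>hat i k)"
  shows "(\<forall>i \<in> {1..N}. (\<lambda>k. vec_norm2 (\<Upsilon>hat i k - \<Upsilon> k)) \<longlonglongrightarrow> 0) \<and>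
    (pos_def_mat (N * q) \<P> \<and> lq_optimal \<A> \<B> \<Q> \<R> \<K> \<P> \<longrightarrow>
       (\<forall>i \<in> {1..N}. (\<lambda>k. vec_norm2 (y i k - y 0 k)) \<longlonglongrightarrow> 0) \<and>
       (\<forall>s. finite_cost \<Q> \<R> \<Upsilon> ubar s) \<and>
       (\<lambda>s. lq_cost \<Q> \<R> \<Upsilon> ubar s - \<Upsilon> s \<bullet> (\<P> *\<^sub>v \<Upsilon> s)) \<longlonglongrightarrow> 0)"
proof -

  \<comment> \<open>Shapes of the global matrices\<close>
  define d where "d = N * q"
  define mm where "mm = offset m (Suc N)"
  have d0: "d > 0" using N q by (simp add: d_def)
  have off_q: "offset (\<lambda>_. q) (Suc N) = d" by (simp add: offset_const d_def)
  have calA1: "\<A> = 1\<^sub>m d" by (simp add: calA kron_one_one d_def)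
  have Ac: "\<A> \<in> carrier_mat d d" by (simp add: calA1)
  have Bc': "\<B> \<in> carrier_mat d mm"
    unfolding calB off_q[symmetric] mm_def by (intro block_diag_carrier mult_carrier_mat[OF C B]) auto
  have Rc: "\<R> \<in> carrier_mat mm mm"
    unfolding calR mm_def using R by (intro block_diag_carrier) (auto simp: pos_def_mat_def)
  have Qc: "\<Q> \<in> carrier_mat d d"
    using Q by (auto simp: calQ kron_def d_def pos_semidef_mat_def)
  have Pc: "\<P> \<in> carrier_mat d d" using P by (simp add: d_def)
  have Kc: "\<K> \<in> carrier_mat mm d"
    unfolding K by (rule lq_gain_carrier[OF Ac Bc' Rc Pc invRB])
  have BKc: "\<B> * \<K> \<in> carrier_mat d d" using Bc' Kc by simp
  have Bl: "\<B>c l \<in> carrier_mat d (m l)" for l unfolding Bc using Bc' by (rule block_col_carrier)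
  have Kl: "\<K>r l \<in> carrier_mat (m l) d" for l unfolding Kr using Kc by (rule block_row_carrier)
  have BKl: "\<B>c l * \<K>r l \<in> carrier_mat d d" for l using Bl Kl by (rule mult_carrier_mat)
  have Fc: "F i \<in> carrier_mat (r i * q) d" if "i \<in> {1..N}" for i
    using F[OF that] by (auto simp: zero_identity_blocks_def kron_def d_def)
  have Phic: "\<Phi> i \<in> carrier_mat d (r i * q)" if "i \<in> {1..N}" for i
    using Phi[OF that] by (simp add: d_def)
  have par: "par i \<in> {0..N}" if "i \<in> {1..N}" for i
  proof -
    have "(par i, i) \<in> E" using tree that unfolding spanning_tree_parent_def by blast
    then show ?thesis using graph by blast
  qed
  \<comment> \<open>The leader may be a parent; the convention \<open>B 0 = 0\<close> lets it be
    treated like any other agent.\<close>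
  have B': "B i \<in> carrier_mat (n i) (m i)" if "i \<in> {0..N}" for i
    using B[of i] B0 that by (cases "i = 0") auto

  \<comment> \<open>A common form of the two feedforward cases\<close>
  define c1 where "c1 i \<longleftrightarrow> ff_case1 (B i) (C i) \<and>
      (\<forall>k. u_ff i k = feedforward (minv (B i)) (minv (C i * B i))
        (A i) (A (par i)) (B (par i)) (C (par i)) (x i k) (x (par i) k) (u (par i) k))" for i
  \<comment> \<open>The case is fixed per agent, uniformly in time, so a single pair of gains
    describes the feedforward at all \<open>k\<close>.\<close>
  define G where "G i = (if c1 i then minv (B i) else pinv (B i))" for i
  define H where "H i = (if c1 i then minv (C i * B i) else pinv (C i * B i))" for i
  have GH: "ff_case1 (B i) (C i) \<and> G i = minv (B i) \<and> H i = minv (C i * B i) \<or>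
       ff_case2 (A i) (B i) (C i) (A (par i)) (B (par i)) (C (par i)) \<and> G i = pinv (B i) \<and> H i = pinv (C i * B i)"
    and u_ff: "u_ff i k = feedforward (G i) (H i)
       (A i) (A (par i)) (B (par i)) (C (par i)) (x i k) (x (par i) k) (u (par i) k)"
    if i: "i \<in> {1..N}" for i k
  proof -
    have "(ff_case1 (B i) (C i) \<and> G i = minv (B i) \<and> H i = minv (C i * B i) \<or>
       ff_case2 (A i) (B i) (C i) (A (par i)) (B (par i)) (C (par i)) \<and> G i = pinv (B i) \<and> H i = pinv (C i * B i)) \<and>
      (\<forall>k. u_ff i k = feedforward (G i) (H i)
       (A i) (A (par i)) (B (par i)) (C (par i)) (x i k) (x (par i) k) (u (par i) k))"
    proof (cases "c1 i")
      case True
      then have "G i = minv (B i)" "H i = minv (C i * B i)" by (simp_all add: G_def H_def)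
      with True show ?thesis unfolding c1_def by metis
    next
      case False
      then have "G i = pinv (B i)" "H i = pinv (C i * B i)" by (simp_all add: G_def H_def)
      with False ff[OF i] show ?thesis unfolding c1_def by metis
    qed
    then show "ff_case1 (B i) (C i) \<and> G i = minv (B i) \<and> H i = minv (C i * B i) \<or>
       ff_case2 (A i) (B i) (C i) (A (par i)) (B (par i)) (C (par i)) \<and> G i = pinv (B i) \<and> H i = pinv (C i * B i)"
      "u_ff i k = feedforward (G i) (H i)
       (A i) (A (par i)) (B (par i)) (C (par i)) (x i k) (x (par i) k) (u (par i) k)"
      by blast+
  qed

  \<comment> \<open>Shapes of the trajectories\<close>
  have hatc: "\<Upsilon>hat i k \<in> carrier_vec d" if i: "i \<in> {1..N}" for i k
  proof (cases k)
    case (Suc k')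
    \<comment> \<open>No induction on time: a vector sum has the dimension of its last summand, here
      the one headed by \<open>\<Phi> i\<close>.\<close>
    show ?thesis
      using observer[OF i, of k'] Phic[OF i] by (intro carrier_vecI) (simp add: Suc)
  qed (use hat_init[OF i] in \<open>simp add: d_def\<close>)
  have fbc: "u_fb i k \<in> carrier_vec (m i)" if i: "i \<in> {1..N}" for i k
    unfolding fb[OF i] using Kl hatc[OF i] by (rule mult_mat_vec_carrier)
  have ubarc: "ubar k \<in> carrier_vec mm" for k
    unfolding ubar mm_def using fbc by (rule stack_carrier)
  have uc: "u i k \<in> carrier_vec (m i)" if i: "i \<in> {0..N}" for i k
  proof (cases "i = 0")
    case False
    then have i: "i \<in> {1..N}" using i by auto
    \<comment> \<open>Again the last summand, \<open>u_fb i k\<close>, fixes the dimension; so the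
      recursive dependence of \<open>u\<close> on the parent's input calls for no induction along
      the tree.\<close>
    show ?thesis
      using control[OF i, of k] fbc[OF i, of k] by (intro carrier_vecI) auto
  qed (simp add: u0)
  have x_step: "x i (k + 1) = A i *\<^sub>v x i k + B i *\<^sub>v u i k" and xc: "x i k \<in> carrier_vec (n i)"
    if i: "i \<in> {0..N}" for i k
  proof -
    show xc: "x i k \<in> carrier_vec (n i)" for k
    proof (induction k)
      case (Suc k)
      show ?case
      proof (cases "i = 0")
        case True
        then show ?thesis using leader[of k] A[OF i] Suc by (auto intro!: mult_mat_vec_carrier)
      next
        case False
        then have "x i (k + 1) = A i *\<^sub>v x i k + B i *\<^sub>v u i k" using i follower by simp
        then show ?thesis using B'[OF i] by (intro carrier_vecI) simp
      qed
    qed (rule x_init[OF i])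
    show "x i (k + 1) = A i *\<^sub>v x i k + B i *\<^sub>v u i k"
    proof (cases "i = 0")
      case True
      have "B 0 *\<^sub>v u 0 k = 0\<^sub>v (n 0)" by (intro eq_vecI) (auto simp: B0 u0)
      then show ?thesis
        using True leader[of k] mult_mat_vec_carrier[OF A[OF i] xc[of k]] by simp
    qed (use i follower in simp)
  qed
  have yc: "y i k \<in> carrier_vec q" if "i \<in> {0..N}" for i k
    unfolding outputs[OF that] using C[OF that] xc[OF that] by (rule mult_mat_vec_carrier)

  \<comment> \<open>Dynamics of the tree errors\<close>
  define \<epsilon> where "\<epsilon> i k = y i k - y (par i) k" for i k
  have epsc: "\<epsilon> i k \<in> carrier_vec q" if i: "i \<in> {1..N}" for i k
    using yc[of i k] yc[OF par[OF i], of k] i by (simp add: \<epsilon>_def)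
  have Ups: "\<Upsilon> k = stack N (\<lambda>i. \<epsilon> i k)" for k by (simp add: errors \<epsilon>_def)
  have Upsc: "\<Upsilon> k \<in> carrier_vec d" for k
    unfolding Ups off_q[symmetric] using epsc by (rule stack_carrier)
  \<comment> \<open>The full input of the parent, feedback included, is compensated by the
    feedforward, so each tree edge is handled in isolation.\<close>
  have eps_step: "\<epsilon> i (k + 1) = \<epsilon> i k + C i * B i *\<^sub>v u_fb i k" if i: "i \<in> {1..N}" for i k
  proof -
    have i0: "i \<in> {0..N}" using i by auto
    note p = par[OF i]
    note cancels = feedforward_cancels[OF A[OF i0] B[OF i] C[OF i0] A[OF p] B'[OF p] C[OF p] GH[OF i]]
    show ?thesis
      unfolding \<epsilon>_def outputs[OF i0] outputs[OF p] x_step[OF i0] x_step[OF p] control[OF i] u_ff[OF i]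
      by (rule feedforward_error_step[OF A[OF i0] B[OF i] C[OF i0] A[OF p] B'[OF p] C[OF p] cancels
            xc[OF i0] xc[OF p] uc[OF p] fbc[OF i]])
  qed
  have Ups_step: "\<Upsilon> (k + 1) = \<Upsilon> k + \<B> *\<^sub>v ubar k" for k
  proof -
    have dc: "u_fb i k \<in> carrier_vec (dim_col (C i * B i))" "C i * B i *\<^sub>v u_fb i k \<in> carrier_vec q"
      if i: "i \<in> {1..N}" for i
      using fbc[OF i, of k] B[OF i] C[of i] i
      by (auto intro!: mult_mat_vec_carrier[of _ q "m i"])
    have "\<B> *\<^sub>v ubar k = stack N (\<lambda>i. C i * B i *\<^sub>v u_fb i k)"
      unfolding calB ubar using dc by (intro block_diag_mult_stack)
    then have "\<Upsilon> k + \<B> *\<^sub>v ubar k = stack N (\<lambda>i. \<epsilon> i k + C i * B i *\<^sub>v u_fb i k)"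
      unfolding Ups using stack_add[of N "\<lambda>i. \<epsilon> i k" "\<lambda>_. q"] epsc dc(2) by simp
    also have "\<dots> = \<Upsilon> (k + 1)" unfolding Ups by (rule stack_cong) (rule eps_step[symmetric])
    finally show ?thesis ..
  qed

  \<comment> \<open>Dynamics of the observer errors\<close>
  define e where "e i k = \<Upsilon>hat i k - \<Upsilon> k" for i k
  have ec: "e i k \<in> carrier_vec d" if "i \<in> {1..N}" for i k
    using hatc[OF that] Upsc by (simp add: e_def)
  have hat_e: "\<Upsilon>hat i k = \<Upsilon> k + e i k" if "i \<in> {1..N}" for i k
    using hatc[OF that, of k] Upsc[of k] by (intro eq_vecI) (auto simp: e_def)
  have Ke: "\<K>r i *\<^sub>v e i k \<in> carrier_vec (m i)" if "i \<in> {1..N}" for i k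
    using Kl ec[OF that] by (rule mult_mat_vec_carrier)
  have ubar_e: "ubar k = \<K> *\<^sub>v \<Upsilon> k + stack N (\<lambda>i. \<K>r i *\<^sub>v e i k)" for k
  proof -
    have "\<K> *\<^sub>v \<Upsilon> k = stack N (\<lambda>i. \<K>r i *\<^sub>v \<Upsilon> k)"
      unfolding Kr using Kc Upsc by (intro stack_block_row) (simp_all add: mm_def)
    then have "\<K> *\<^sub>v \<Upsilon> k + stack N (\<lambda>i. \<K>r i *\<^sub>v e i k) = stack N (\<lambda>i. \<K>r i *\<^sub>v \<Upsilon> k + \<K>r i *\<^sub>v e i k)"
      using stack_add[of N "\<lambda>i. \<K>r i *\<^sub>v \<Upsilon> k" m "\<lambda>i. \<K>r i *\<^sub>v e i k"] Ke
        mult_mat_vec_carrier[OF Kl Upsc] by simp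
    also have "\<dots> = ubar k"
      unfolding ubar
      by (intro stack_cong) (simp add: fb hat_e mult_add_distrib_mat_vec[OF Kl Upsc ec])
    finally show ?thesis ..
  qed

  let ?H = "\<lambda>i l. if i = l then \<A> + \<B> * \<K> - \<B>c i * \<K>r i - \<Phi> i * F i else - (\<B>c l * \<K>r l)"
  have PF: "\<Phi> i * F i \<in> carrier_mat d d" if "i \<in> {1..N}" for i
    using Phic[OF that] Fc[OF that] by (rule mult_carrier_mat)
  have Hc': "?H i l \<in> carrier_mat d d" if "i \<in> {1..N}" "l \<in> {1..N}" for i l
    using BKl[of l] minus_carrier_mat[OF PF[OF that(1)]] by (cases "i = l") simp_all
  let ?g = "\<lambda>l v a. (\<B>c l * \<K>r l *\<^sub>v v) $ a"
  have g_diff: "?g l (v - w) a = ?g l v a - ?g l w a"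
    if "v \<in> carrier_vec d" "w \<in> carrier_vec d" "a < d" for l v w a
    using mult_minus_distrib_mat_vec[OF BKl that(1,2), of l] Bl[of l] that by simp
  have g_sum: "(\<Sum>l\<in>{1..N}. ?g l v a) = (\<B> * \<K> *\<^sub>v v) $ a" if "v \<in> carrier_vec d" "a < d" for v a
    unfolding Bc Kr using block_col_row_sum[of \<B> d m N \<K> v a] Bc' Kc that by (simp add: mm_def)
  have Bubar: "(\<B> *\<^sub>v ubar k) $ a = (\<Sum>l\<in>{1..N}. ?g l (\<Upsilon>hat l k) a)" if a: "a < d" for k a
  proof -
    have "\<B> *\<^sub>v ubar k = finsum_vec TYPE(real) d (\<lambda>l. \<B>c l *\<^sub>v u_fb l k) {1..N}"
      unfolding ubar Bc using Bc' fbc by (intro mult_mat_stack) (simp_all add: mm_def)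
    also have "\<dots> $ a = (\<Sum>l\<in>{1..N}. (\<B>c l *\<^sub>v u_fb l k) $ a)"
      using a by (intro index_finsum_vec) (auto intro!: mult_mat_vec_carrier[OF Bl fbc])
    also have "\<dots> = (\<Sum>l\<in>{1..N}. ?g l (\<Upsilon>hat l k) a)"
      by (intro sum.cong refl) (simp add: fb assoc_mult_mat_vec[OF Bl Kl hatc])
    finally show ?thesis .
  qed
  define E where "E k = stack N (\<lambda>i. e i k)" for k
  have off_d: "offset (\<lambda>_. d) (Suc N) = N * d" by (simp add: offset_const)
  \<comment> \<open>Subtracting the two recursions leaves \<open>e i\<close> plus the sum over all
    \<open>l\<close> of \<open>\<B>c l * \<K>r l\<close> applied to \<open>e i - e l\<close>, minus
    \<open>\<Phi> i * F i\<close> applied to \<open>e i\<close>. The terms in \<open>e i\<close> sum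
    to \<B> times \<K>; the term \<open>- e l\<close> is off-diagonal, except for
    \<open>l = i\<close>, where it is the \<open>- \<B>c i * \<K>r i\<close> in the diagonal
    block.\<close>
  have E_step: "E (Suc k) = block_mat N d ?H *\<^sub>v E k" for k
  proof -
    have "block_mat N d ?H *\<^sub>v E k = stack N (\<lambda>i. finsum_vec TYPE(real) d (\<lambda>l. ?H i l *\<^sub>v e l k) {1..N})"
      unfolding E_def using Hc' ec by (rule block_mat_mult_stack)
    also have "\<dots> = stack N (\<lambda>i. e i (Suc k))"
    proof (rule stack_cong, rule eq_vecI)
      fix i assume i: "i \<in> {1..N}"
      have split: "(\<Sum>l\<in>{1..N}. h l) = h i + (\<Sum>l\<in>{1..N} - {i}. h l)" for h :: "nat \<Rightarrow> real"
        using i by (intro sum.remove) auto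
      have fin: "finsum_vec TYPE(real) d (\<lambda>l. ?H i l *\<^sub>v e l k) {1..N} \<in> carrier_vec d"
        by (intro finsum_vec_closed Pi_I mult_mat_vec_carrier[OF Hc'[OF i] ec])
      then show "dim_vec (finsum_vec TYPE(real) d (\<lambda>l. ?H i l *\<^sub>v e l k) {1..N}) = dim_vec (e i (Suc k))"
        using carrier_vecD[OF fin] carrier_vecD[OF ec[OF i, of "Suc k"]] by (simp only:)
      fix a assume "a < dim_vec (e i (Suc k))"
      then have a: "a < d" using carrier_vecD[OF ec[OF i, of "Suc k"]] by simp
      have diag: "(?H i i *\<^sub>v e i k) $ a
        = e i k $ a + (\<B> * \<K> *\<^sub>v e i k) $ a - ?g i (e i k) a - (\<Phi> i * F i *\<^sub>v e i k) $ a"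
      proof -
        have M1: "\<A> + \<B> * \<K> \<in> carrier_mat d d" using Ac BKc by simp
        have M2: "\<A> + \<B> * \<K> - \<B>c i * \<K>r i \<in> carrier_mat d d" using M1 BKl[of i] by (intro minus_carrier_mat)
        have "?H i i *\<^sub>v e i k = (\<A> *\<^sub>v e i k + \<B> * \<K> *\<^sub>v e i k - \<B>c i * \<K>r i *\<^sub>v e i k) - \<Phi> i * F i *\<^sub>v e i k"
          using minus_mult_distrib_mat_vec[OF M2 PF[OF i] ec[OF i, of k]]
            minus_mult_distrib_mat_vec[OF M1 BKl[of i] ec[OF i, of k]]
            add_mult_distrib_mat_vec[OF Ac BKc ec[OF i, of k]] by simp
        moreover have "\<A> *\<^sub>v e i k = e i k" using ec[OF i, of k] by (simp add: calA1)
        ultimately show ?thesis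
          using a Bl[of i] Phic[OF i] Bc' ec[OF i, of k] by simp
      qed
      have off: "(?H i l *\<^sub>v e l k) $ a = - ?g l (e l k) a" if "l \<in> {1..N} - {i}" for l
      proof -
        have "- (\<B>c l * \<K>r l) *\<^sub>v e l k = - (\<B>c l * \<K>r l *\<^sub>v e l k)"
          using ec[of l k] BKl[of l] that by (intro uminus_mult_mat_vec) auto
        then show ?thesis using a Bl[of l] that by auto
      qed
      \<comment> \<open>The agent's own input equals \<open>\<K>r i\<close> applied to its estimate,
        so it supplies exactly the summand \<open>l = i\<close> that the prediction sum
        omits.\<close>
      have obs: "\<Upsilon>hat i (Suc k) $ a = \<Upsilon>hat i k $ a + (\<Sum>l\<in>{1..N}. ?g l (\<Upsilon>hat i k) a) - (\<Phi> i * F i *\<^sub>v e i k) $ a"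
      proof -
        have "\<Phi> i *\<^sub>v (F i *\<^sub>v \<Upsilon> k - F i *\<^sub>v \<Upsilon>hat i k) = \<Phi> i *\<^sub>v (F i *\<^sub>v (\<Upsilon> k - \<Upsilon>hat i k))"
          using mult_minus_distrib_mat_vec[OF Fc[OF i] Upsc hatc[OF i]] by simp
        also have "\<dots> = \<Phi> i * F i *\<^sub>v (\<Upsilon> k - \<Upsilon>hat i k)"
          using Upsc[of k] hatc[OF i, of k] by (intro assoc_mult_mat_vec[symmetric, OF Phic[OF i] Fc[OF i]]) simp
        also have "\<Upsilon> k - \<Upsilon>hat i k = - e i k"
          using Upsc[of k] hatc[OF i, of k] by (intro eq_vecI) (auto simp: e_def)
        also have "\<Phi> i * F i *\<^sub>v (- e i k) = - (\<Phi> i * F i *\<^sub>v e i k)"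
          using PF[OF i] ec[OF i, of k] by (intro eq_vecI) auto
        finally have inj: "\<Phi> i *\<^sub>v (F i *\<^sub>v \<Upsilon> k - F i *\<^sub>v \<Upsilon>hat i k) = - (\<Phi> i * F i *\<^sub>v e i k)" .
        let ?s = "finsum_vec TYPE(real) (N * q) (\<lambda>l. \<B>c l * \<K>r l *\<^sub>v \<Upsilon>hat i k) ({1..N} - {i})"
        have sc: "?s \<in> carrier_vec d"
          unfolding d_def[symmetric]
          by (intro finsum_vec_closed) (auto intro!: mult_mat_vec_carrier[OF BKl hatc[OF i]])
        have s: "?s $ a = (\<Sum>l\<in>{1..N} - {i}. ?g l (\<Upsilon>hat i k) a)"
          unfolding d_def[symmetric] using a
          by (intro index_finsum_vec) (auto intro!: mult_mat_vec_carrier[OF BKl hatc[OF i]])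
        have "\<Upsilon>hat i (Suc k) = \<Upsilon>hat i k + \<B>c i * \<K>r i *\<^sub>v \<Upsilon>hat i k + ?s + - (\<Phi> i * F i *\<^sub>v e i k)"
          using observer[OF i, of k] hatc[OF i, of k]
          by (simp only: inj fb[OF i] assoc_mult_mat_vec[OF Bl Kl hatc[OF i]] calA1 one_mult_mat_vec Suc_eq_plus1)
        then have "\<Upsilon>hat i (Suc k) $ a = \<Upsilon>hat i k $ a + ?g i (\<Upsilon>hat i k) a + ?s $ a - (\<Phi> i * F i *\<^sub>v e i k) $ a"
          using a carrier_vecD[OF sc] Bl[of i] Phic[OF i] by simp
        then show ?thesis
          unfolding s split by (simp only: add.assoc)
      qed
      have g_e: "?g l (e j k) a = ?g l (\<Upsilon>hat j k) a - ?g l (\<Upsilon> k) a" if "j \<in> {1..N}" for l j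
        unfolding e_def using hatc[OF that] Upsc a by (rule g_diff)
      have "finsum_vec TYPE(real) d (\<lambda>l. ?H i l *\<^sub>v e l k) {1..N} $ a = (\<Sum>l\<in>{1..N}. (?H i l *\<^sub>v e l k) $ a)"
        by (intro index_finsum_vec finite_atLeastAtMost a Pi_I mult_mat_vec_carrier[OF Hc'[OF i] ec])
      also have "\<dots> = (?H i i *\<^sub>v e i k) $ a + (\<Sum>l\<in>{1..N} - {i}. (?H i l *\<^sub>v e l k) $ a)"
        by (rule split)
      also have "(\<Sum>l\<in>{1..N} - {i}. (?H i l *\<^sub>v e l k) $ a) = (\<Sum>l\<in>{1..N} - {i}. - ?g l (e l k) a)"
        using off by (rule sum.cong[OF refl])
      \<comment> \<open>Completing the sum by \<open>l = i\<close> produces a term that cancels the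
        one subtracted in \<open>diag\<close>.\<close>
      also have "\<dots> = ?g i (e i k) a - (\<Sum>l\<in>{1..N}. ?g l (e l k) a)"
        unfolding split sum_negf by simp
      also have "(\<Sum>l\<in>{1..N}. ?g l (e l k) a) = (\<Sum>l\<in>{1..N}. ?g l (\<Upsilon>hat l k) a) - (\<Sum>l\<in>{1..N}. ?g l (\<Upsilon> k) a)"
        unfolding sum_subtractf[symmetric] by (rule sum.cong[OF refl], rule g_e)
      also note diag
      also have "(\<B> * \<K> *\<^sub>v e i k) $ a = (\<Sum>l\<in>{1..N}. ?g l (\<Upsilon>hat i k) a) - (\<Sum>l\<in>{1..N}. ?g l (\<Upsilon> k) a)"
        unfolding g_sum[OF ec[OF i] a, symmetric] sum_subtractf[symmetric] using g_e[OF i] by simp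
      finally have "finsum_vec TYPE(real) d (\<lambda>l. ?H i l *\<^sub>v e l k) {1..N} $ a =
          e i k $ a + (\<Sum>l\<in>{1..N}. ?g l (\<Upsilon>hat i k) a) - (\<Phi> i * F i *\<^sub>v e i k) $ a
          - (\<Sum>l\<in>{1..N}. ?g l (\<Upsilon>hat l k) a)"
        by simp
      moreover have "e i (Suc k) $ a = \<Upsilon>hat i (Suc k) $ a - \<Upsilon> (Suc k) $ a"
        "e i k $ a = \<Upsilon>hat i k $ a - \<Upsilon> k $ a"
        using a carrier_vecD[OF Upsc] by (simp_all add: e_def)
      moreover have "\<Upsilon> (Suc k) $ a = \<Upsilon> k $ a + (\<Sum>l\<in>{1..N}. ?g l (\<Upsilon>hat l k) a)"
        using Ups_step[of k] Bubar[OF a, of k] a Bc' by simp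
      ultimately show "finsum_vec TYPE(real) d (\<lambda>l. ?H i l *\<^sub>v e l k) {1..N} $ a = e i (Suc k) $ a"
        using obs by simp
    qed
    finally show ?thesis by (simp add: E_def)
  qed
  \<comment> \<open>The recursion is autonomous, hence the zero disturbance.\<close>
  have "l1_seq (N * d) E"
  proof (rule stable_recursion_l1[where d = "\<lambda>_. 0\<^sub>v (N * d)"])
    show Hm: "block_mat N d ?H \<in> carrier_mat (N * d) (N * d)" by (simp add: block_mat_def)
    show "N * d > 0" using N d0 by simp
    show "stable_mat (block_mat N d ?H)" using Hc unfolding d_def .
    show "E 0 \<in> carrier_vec (N * d)" unfolding E_def off_d[symmetric] using ec by (rule stack_carrier)
    show "l1_seq (N * d) (\<lambda>_. 0\<^sub>v (N * d))" by (rule l1_seq_zero)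
    show "E (Suc k) = block_mat N d ?H *\<^sub>v E k + 0\<^sub>v (N * d)" for k
      unfolding E_step using Hm by (intro eq_vecI) auto
  qed
  then have e_l1: "l1_seq d (e i)" if "i \<in> {1..N}" for i
    using that l1_seq_stack_iff[of N e "\<lambda>_. d"] ec unfolding E_def off_d by blast
  have observers: "(\<lambda>k. vec_norm2 (\<Upsilon>hat i k - \<Upsilon> k)) \<longlonglongrightarrow> 0" if "i \<in> {1..N}" for i
    using l1_seq_norm_tendsto_0[OF e_l1[OF that]] by (simp add: e_def)

  \<comment> \<open>Output consensus and asymptotic optimality\<close>
  have optimal: "(\<forall>i \<in> {1..N}. (\<lambda>k. vec_norm2 (y i k - y 0 k)) \<longlonglongrightarrow> 0) \<and>
       (\<forall>s. finite_cost \<Q> \<R> \<Upsilon> ubar s) \<and>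
       (\<lambda>s. lq_cost \<Q> \<R> \<Upsilon> ubar s - \<Upsilon> s \<bullet> (\<P> *\<^sub>v \<Upsilon> s)) \<longlonglongrightarrow> 0"
    if pd: "pos_def_mat (N * q) \<P>" and opt: "lq_optimal \<A> \<B> \<Q> \<R> \<K> \<P>"
  proof -
    have stable: "stable_mat (\<A> + \<B> * \<K>)"
      using lq_optimal_stable[OF Ac Bc' Kc d0 _ opt] pd by (simp add: d_def)
    define w where "w k = stack N (\<lambda>i. \<K>r i *\<^sub>v e i k)" for k
    have w: "l1_seq mm w"
      unfolding w_def mm_def using l1_seq_stack_iff[of N "\<lambda>i k. \<K>r i *\<^sub>v e i k" m] Ke
        l1_seq_mult_mat[OF Kl e_l1] by blast
    \<comment> \<open>Here the disturbance is \<B> applied to \<open>w\<close>; it is summable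
      because the observer errors are, which is where their geometric decay pays off.\<close>
    have Ups_l1: "l1_seq d \<Upsilon>"
    proof (rule stable_recursion_l1[OF _ d0 stable Upsc])
      show "\<A> + \<B> * \<K> \<in> carrier_mat d d" using Ac BKc by simp
      show "l1_seq d (\<lambda>k. \<B> *\<^sub>v w k)" using Bc' w by (rule l1_seq_mult_mat)
      fix k
      have KU: "\<K> *\<^sub>v \<Upsilon> k \<in> carrier_vec mm" using Kc Upsc by (rule mult_mat_vec_carrier)
      have wk: "w k \<in> carrier_vec mm" using w by (rule l1_seq_carrier)
      have "\<Upsilon> (Suc k) = \<Upsilon> k + (\<B> *\<^sub>v (\<K> *\<^sub>v \<Upsilon> k) + \<B> *\<^sub>v w k)"
        using Ups_step[of k] mult_add_distrib_mat_vec[OF Bc' KU wk] by (simp add: ubar_e w_def)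
      also have "\<dots> = \<Upsilon> k + \<B> *\<^sub>v (\<K> *\<^sub>v \<Upsilon> k) + \<B> *\<^sub>v w k"
        using Upsc[of k] mult_mat_vec_carrier[OF Bc' KU] mult_mat_vec_carrier[OF Bc' wk]
        by (rule assoc_add_vec[symmetric])
      also have "\<Upsilon> k + \<B> *\<^sub>v (\<K> *\<^sub>v \<Upsilon> k) = (\<A> + \<B> * \<K>) *\<^sub>v \<Upsilon> k"
        using add_mult_distrib_mat_vec[OF Ac BKc Upsc[of k]] assoc_mult_mat_vec[OF Bc' Kc Upsc[of k]] Upsc[of k]
        by (simp add: calA1)
      finally show "\<Upsilon> (Suc k) = (\<A> + \<B> * \<K>) *\<^sub>v \<Upsilon> k + \<B> *\<^sub>v w k" .
    qed
    have ubar_l1: "l1_seq mm ubar"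
      using l1_seq_add[OF l1_seq_mult_mat[OF Kc Ups_l1] w] by (simp add: ubar_e[abs_def] w_def)
    have eps_l1: "l1_seq q (\<epsilon> i)" if "i \<in> {1..N}" for i
      using that l1_seq_stack_iff[of N \<epsilon> "\<lambda>_. q"] epsc Ups_l1 unfolding Ups[abs_def] off_q by blast
    have consensus: "(\<lambda>k. vec_norm2 (y i k - y 0 k)) \<longlonglongrightarrow> 0" if i: "i \<in> {1..N}" for i
    proof -
      have "(0, i) \<in> {(par l, l) | l. l \<in> {1..N}}\<^sup>*" using tree i by (auto simp: spanning_tree_parent_def)
      \<comment> \<open>Along the tree path from the root, the deviation from the leader is a finite
        sum of tree errors, each of them summable.\<close>
      then have "l1_seq q (\<lambda>k. y i k - y 0 k)"
      proof (induction rule: rtrancl_induct)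
        case base
        have "y 0 k - y 0 k = 0\<^sub>v q" for k using yc[of 0 k] by (intro minus_cancel_vec) simp
        then show ?case using l1_seq_zero[of q] by simp
      next
        case (step j l)
        then have l: "l \<in> {1..N}" and j: "j = par l" by auto
        have "y l k - y 0 k = \<epsilon> l k + (y j k - y 0 k)" for k
          using yc[of l k] yc[of 0 k] yc[OF par[OF l], of k] l by (intro eq_vecI) (auto simp: \<epsilon>_def j)
        then show ?case using l1_seq_add[OF eps_l1[OF l] step.IH] by simp
      qed
      then show ?thesis by (rule l1_seq_norm_tendsto_0)
    qed
    let ?f = "\<lambda>k. stage_cost \<Q> \<R> (\<Upsilon> k) (ubar k)"
    have f: "summable ?f"
      unfolding stage_cost_def
      by (intro summable_add l1_seq_summable_quadratic[OF Qc Ups_l1] l1_seq_summable_quadratic[OF Rc ubar_l1])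
    have "(\<lambda>s. lq_cost \<Q> \<R> \<Upsilon> ubar s - \<Upsilon> s \<bullet> (\<P> *\<^sub>v \<Upsilon> s)) \<longlonglongrightarrow> 0 - 0"
      unfolding lq_cost_def
      by (intro tendsto_diff suminf_tail_tendsto_0[OF f] l1_seq_quadratic_tendsto_0[OF Pc Ups_l1])
    moreover have "finite_cost \<Q> \<R> \<Upsilon> ubar s" for s
      unfolding finite_cost_def using summable_ignore_initial_segment[OF f, of s] by (simp add: add.commute)
    ultimately show ?thesis using consensus by simp
  qed
  show ?thesis using observers optimal by blast
qed

end
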